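(* Let $N\ge 2$, $q\in(0,1)$, and let $P=(p_{ij})$ be an irreducible row-stochastic $N\times N$ matrix. Consider the push-sum algorithm driven by i.i.d. updates $K(t)$ with message probability matrix $P$ (see context). Then, for every initial vector $x(0)\in\mathbb R^N$, almost surely $$\limsup_{t\to\infty}\frac1t\max_i\log\left|\frac{x_i(t)}{w_i(t)}-\bar x\right|\le \frac12\log\rho\Big((I-J)\big(P_q^\top P_q+q^2(\Gamma-P^\top P)\big)(I-J)\Big),$$ where $\Gamma$ is the diagonal matrix with $\Gamma_{ii}=\sum_j p_{ji}$ and $\rho(\cdot)$ denotes the spectral radius. Furthermore, if $P$ is symmetric, then almost surely $$\limsup_{t\to\infty}\frac1t\max_i\log\left|\frac{x_i(t)}{w_i(t)}-\bar x\right|\le \frac12\log\big((1-q)^2+2q(1-q)\lambda_2+q^2\big),$$ where $\lambda_2$ is the second largest eigenvalue of $P$ (eigenvalues listed with multiplicity in decreasing order $\lambda_1=1\ge\lambda_2\ge\dots\ge\lambda_N$).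
   Context: Setup: $N\ge2$, $[N]=\{1,\dots,N\}$, $e_1,\dots,e_N$ the standard basis of $\mathbb R^N$, $\mathbf 1$ the all-ones vector, $J=\mathbf 1\mathbf 1^\top/N$. $P=(p_{ij})$ is a row-stochastic $N\times N$ matrix (the message probability matrix), $q$ a constant, and $P_q=(1-q)I+qP$. Let $\beta_1,\dots,\beta_N$ be independent random variables with values in $[N]$ and $\mathbb P(\beta_i=j)=p_{ij}$, and set $K=(1-q)I+q\sum_{i=1}^N e_ie_{\beta_i}^\top$ (each node $i$ sends a fraction $q$ of its values to the single random recipient $\beta_i$). $(K(t))_{t\ge1}$ are i.i.d. copies of $K$. Push-sum algorithm: given $x(0)\in\mathbb R^N$ and $w(0)=\mathbf 1$, set $x(t)^\top=x(t-1)^\top K(t)$, $w(t)^\top=w(t-1)^\top K(t)$ for $t\ge1$; $\bar x=\frac1N\sum_i x_i(0)$. (For $q<1$ all $w_i(t)>0$.) Irreducibility of $P$ means the directed graph with an edge $i\to j$ whenever $p_{ij}>0$ is strongly connected (in the paper $P$ is supported on the edges of a connected graph). *)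

theory Defs
  imports "HOL-Probability.Probability" "Jordan_Normal_Form.Spectral_Radius"
begin

text \<open>Matrices are Jordan_Normal_Form matrices of dimension N x N, nodes are 0..N-1.\<close>

definition row_stochastic :: "nat \<Rightarrow> real mat \<Rightarrow> bool" where
  "row_stochastic N P \<longleftrightarrow> P \<in> carrier_mat N N \<and>
     (\<forall>i<N. \<forall>j<N. P $$ (i,j) \<ge> 0) \<and> (\<forall>i<N. (\<Sum>j<N. P $$ (i,j)) = 1)"

text \<open>Irreducible: the digraph with an edge i -> j iff p_ij > 0 is strongly connected.\<close>
definition irreducible_mat :: "nat \<Rightarrow> real mat \<Rightarrow> bool" where
  "irreducible_mat N P \<longleftrightarrow>
     (\<forall>i<N. \<forall>j<N. (i,j) \<in> {(a,b). a < N \<and> b < N \<and> P $$ (a,b) > 0}\<^sup>*)"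

text \<open>Entry (i,j) of K(t) = (1-q) I + q sum_i e_i e_{beta_i(t)}^T.\<close>
definition K_entry :: "real \<Rightarrow> (nat \<Rightarrow> nat \<Rightarrow> 'w \<Rightarrow> nat) \<Rightarrow> nat \<Rightarrow> 'w \<Rightarrow> nat \<Rightarrow> nat \<Rightarrow> real" where
  "K_entry q \<beta> t \<omega> i j = (if i = j then 1 - q else 0) + (if \<beta> t i \<omega> = j then q else 0)"

text \<open>Push-sum iteration y(t)^T = y(t-1)^T K(t), y(0) = y0.\<close>
fun push_iter :: "nat \<Rightarrow> real \<Rightarrow> (nat \<Rightarrow> nat \<Rightarrow> 'w \<Rightarrow> nat) \<Rightarrow> (nat \<Rightarrow> real) \<Rightarrow> 'w \<Rightarrow> nat \<Rightarrow> nat \<Rightarrow> real" where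
  "push_iter N q \<beta> y0 \<omega> 0 = y0"
| "push_iter N q \<beta> y0 \<omega> (Suc t) =
     (\<lambda>j. \<Sum>i<N. push_iter N q \<beta> y0 \<omega> t i * K_entry q \<beta> (Suc t) \<omega> i j)"

text \<open>Logarithm with log 0 = -infinity.\<close>
definition elog :: "real \<Rightarrow> ereal" where
  "elog x = (if x > 0 then ereal (ln x) else -\<infinity>)"

text \<open>(1/t) max_i log |x_i(t)/w_i(t) - xbar|\<close>
definition push_rate :: "nat \<Rightarrow> real \<Rightarrow> (nat \<Rightarrow> nat \<Rightarrow> 'w \<Rightarrow> nat) \<Rightarrow> (nat \<Rightarrow> real) \<Rightarrow> 'w \<Rightarrow> nat \<Rightarrow> ereal" where
  "push_rate N q \<beta> x0 \<omega> t =
     ereal (1 / real t) *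
     Max ((\<lambda>i. elog \<bar>push_iter N q \<beta> x0 \<omega> t i / push_iter N q \<beta> (\<lambda>_. 1) \<omega> t i
                       - (\<Sum>k<N. x0 k) / real N\<bar>) ` {..<N})"

definition P_q :: "nat \<Rightarrow> real \<Rightarrow> real mat \<Rightarrow> real mat" where
  "P_q N q P = (1 - q) \<cdot>\<^sub>m 1\<^sub>m N + q \<cdot>\<^sub>m P"

definition J_mat :: "nat \<Rightarrow> real mat" where
  "J_mat N = mat N N (\<lambda>_. 1 / real N)"

definition Gamma_mat :: "nat \<Rightarrow> real mat \<Rightarrow> real mat" where
  "Gamma_mat N P = mat N N (\<lambda>(i,j). if i = j then (\<Sum>k<N. P $$ (k,i)) else 0)"

definition rate_matrix :: "nat \<Rightarrow> real \<Rightarrow> real mat \<Rightarrow> real mat" where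
  "rate_matrix N q P =
     (1\<^sub>m N - J_mat N) *
     ((transpose_mat (P_q N q P) * P_q N q P) + q\<^sup>2 \<cdot>\<^sub>m (Gamma_mat N P - transpose_mat P * P)) *
     (1\<^sub>m N - J_mat N)"

text \<open>Spectral radius of a real matrix: that of its complexification.\<close>
definition spectral_radius_real :: "real mat \<Rightarrow> real" where
  "spectral_radius_real A = spectral_radius (map_mat complex_of_real A)"

end

theory Submission
  imports Defs
begin

text \<open>Put \<open>y = x(0) - xbar 1\<close>, which has zero sum; then \<open>x\<^sub>i(t)/w\<^sub>i(t) - xbar = y\<^sub>i(t)/w\<^sub>i(t)\<close>,
  where \<open>y(t)\<close> is the push-sum iterate of \<open>y\<close>. Numerator: by duality \<open>y\<^sub>j(t)\<close> pairs \<open>y\<close> with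
  \<open>K(1) \<cdots> K(t) e\<^sub>j\<close>, and applying \<open>K(t), \<dots>, K(1)\<close> in this order to \<open>e\<^sub>j\<close> multiplies the expected
  dispersion \<open>|(I - J) u|\<^sup>2\<close> by at most the spectral radius \<open>\<rho>\<close> at each step. Markov's inequality and
  Borel--Cantelli give \<open>y\<^sub>j(t)\<^sup>2 < \<theta>\<^sup>t\<close> eventually, for every \<open>\<theta> > \<rho>\<close>. Denominator: almost surely
  every edge is used in every window \<open>(t - \<epsilon>t, t]\<close> with \<open>t\<close> large, so by irreducibility the node
  of largest weight feeds every other node within such a window, and \<open>w\<^sub>i(t) \<ge> exp (-\<delta>t)\<close>
  eventually, for every \<open>\<delta> > 0\<close>. For symmetric \<open>P\<close> the rate matrix is
  \<open>((1-q)\<^sup>2 + q\<^sup>2) I + 2q(1-q) P - J\<close>, whose nonzero eigenvalues have eigenvectors of zero sum, and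
  irreducibility keeps the eigenvalue 1 of \<open>P\<close> away from those.\<close>

subsection \<open>Quadratic forms and the spectral radius\<close>

lemma smult_mat_mult_vec:
  fixes A :: "'a :: comm_semiring_0 mat"
  assumes "A \<in> carrier_mat n m" "v \<in> carrier_vec m"
  shows "(k \<cdot>\<^sub>m A) *\<^sub>v v = k \<cdot>\<^sub>v (A *\<^sub>v v)"
  using assms by (intro eq_vecI) (auto simp: scalar_prod_def sum_distrib_left mult_ac)

lemma scalar_prod_Cauchy_Schwarz:
  fixes v w :: "real vec"
  assumes "v \<in> carrier_vec n" "w \<in> carrier_vec n"
  shows "(v \<bullet> w)\<^sup>2 \<le> (v \<bullet> v) * (w \<bullet> w)"
  using assms Cauchy_Schwarz_ineq_sum[of "\<lambda>i. v $ i" "\<lambda>i. w $ i" "{0..<n}"]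
  by (simp add: scalar_prod_def power2_eq_square)

lemma pow_mat_mult_vec_add:
  fixes B :: "'a :: semiring_1 mat"
  assumes B: "B \<in> carrier_mat n n" and v: "v \<in> carrier_vec n"
  shows "B ^\<^sub>m (j + k) *\<^sub>v v = B ^\<^sub>m j *\<^sub>v (B ^\<^sub>m k *\<^sub>v v)"
  using v
proof (induction k arbitrary: v)
  case (Suc k)
  have "B ^\<^sub>m (j + Suc k) *\<^sub>v v = B ^\<^sub>m (j + k) *\<^sub>v (B *\<^sub>v v)"
    using B Suc.prems by (simp add: assoc_mult_mat_vec[OF pow_carrier_mat[OF B] B])
  also have "\<dots> = B ^\<^sub>m j *\<^sub>v (B ^\<^sub>m k *\<^sub>v (B *\<^sub>v v))"
    using Suc B by simp
  also have "B ^\<^sub>m k *\<^sub>v (B *\<^sub>v v) = B ^\<^sub>m Suc k *\<^sub>v v"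
    using B Suc.prems by (simp add: assoc_mult_mat_vec[OF pow_carrier_mat[OF B] B])
  finally show ?case .
qed (use B in auto)

lemma scalar_prod_pow_mat_symmetric:
  fixes B :: "real mat"
  assumes B: "B \<in> carrier_mat n n" and sym: "transpose_mat B = B"
    and "v \<in> carrier_vec n" "w \<in> carrier_vec n"
  shows "(B ^\<^sub>m k *\<^sub>v v) \<bullet> w = v \<bullet> (B ^\<^sub>m k *\<^sub>v w)"
  using assms(3,4)
proof (induction k arbitrary: v w)
  case (Suc k)
  have "(B ^\<^sub>m Suc k *\<^sub>v v) \<bullet> w = (B ^\<^sub>m k *\<^sub>v (B *\<^sub>v v)) \<bullet> w"
    using B Suc.prems by (simp add: assoc_mult_mat_vec[OF pow_carrier_mat[OF B] B])
  also have "\<dots> = (transpose_mat B *\<^sub>v v) \<bullet> (B ^\<^sub>m k *\<^sub>v w)"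
    using Suc B sym by (simp del: transpose_transpose)
  also have "\<dots> = v \<bullet> (B *\<^sub>v (B ^\<^sub>m k *\<^sub>v w))"
    by (rule transpose_vec_mult_scalar[OF B mult_mat_vec_carrier[OF pow_carrier_mat[OF B] Suc.prems(2)] Suc.prems(1)])
  also have "B *\<^sub>v (B ^\<^sub>m k *\<^sub>v w) = B ^\<^sub>m Suc k *\<^sub>v w"
    using pow_mat_mult_vec_add[OF B Suc.prems(2), of 1 k] B by simp
  finally show ?case .
qed (use B in auto)

text \<open>By Cauchy--Schwarz and symmetry, the Rayleigh quotients \<open>\<sigma>\<^sub>m\<close> of the powers \<open>B\<^sup>m\<close>
  satisfy \<open>\<sigma>\<^sub>m\<^sup>2 \<le> \<sigma>\<^sub>2\<^sub>m\<close>, so \<open>\<sigma>\<^sub>1 > 1\<close> would force them to grow without bound.\<close>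

lemma rayleigh_le_of_power_bounded:
  fixes B :: "real mat"
  assumes B: "B \<in> carrier_mat n n" and sym: "transpose_mat B = B"
    and bnd: "\<And>k. norm_bound (B ^\<^sub>m k) c"
    and v: "v \<in> carrier_vec n"
  shows "v \<bullet> (B *\<^sub>v v) \<le> v \<bullet> v"
proof (rule ccontr)
  assume *: "\<not> ?thesis"
  have nn: "w \<bullet> w \<ge> 0" if "w \<in> carrier_vec n" for w :: "real vec"
    by (auto simp: scalar_prod_def intro: sum_nonneg)
  have V: "v \<bullet> v > 0"
  proof (rule ccontr)
    assume "\<not> v \<bullet> v > 0"
    then have "v \<bullet> v = 0" using nn[OF v] by simp
    with scalar_prod_Cauchy_Schwarz[OF v, of "B *\<^sub>v v"] B v have "v \<bullet> (B *\<^sub>v v) = 0" by simp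
    with * \<open>v \<bullet> v = 0\<close> show False by simp
  qed
  \<comment> \<open>The Rayleigh quotients are followed along the exponents \<open>2 ^ k\<close>
    only, because Cauchy-Schwarz compares an exponent with its double.\<close>
  define s where "s k = (v \<bullet> (B ^\<^sub>m (2 ^ k) *\<^sub>v v)) / (v \<bullet> v)" for k
  have sq: "(s k)\<^sup>2 \<le> s (Suc k)" for k
  proof -
    let ?w = "B ^\<^sub>m (2 ^ k) *\<^sub>v v"
    have w: "?w \<in> carrier_vec n" by (rule mult_mat_vec_carrier[OF pow_carrier_mat[OF B] v])
    have "(v \<bullet> ?w)\<^sup>2 \<le> (v \<bullet> v) * (?w \<bullet> ?w)" by (rule scalar_prod_Cauchy_Schwarz[OF v w])
    also have "?w \<bullet> ?w = v \<bullet> (B ^\<^sub>m (2 ^ k) *\<^sub>v ?w)"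
      by (rule scalar_prod_pow_mat_symmetric[OF B sym v w])
    also have "B ^\<^sub>m (2 ^ k) *\<^sub>v ?w = B ^\<^sub>m (2 ^ Suc k) *\<^sub>v v"
      using pow_mat_mult_vec_add[OF B v, of "2 ^ k" "2 ^ k"] by (simp add: mult_2)
    finally show ?thesis
      using V by (simp add: s_def power_divide divide_simps power2_eq_square mult_ac)
  qed
  have s0: "s 0 > 1" using * V B by (simp add: s_def)
  have grow: "s k \<ge> s 0 ^ (2 ^ k)" for k
  proof (induction k)
    case (Suc k)
    have "s 0 ^ (2 ^ Suc k) = (s 0 ^ (2 ^ k))\<^sup>2" by (simp add: power_mult[symmetric] mult.commute)
    also have "\<dots> \<le> (s k)\<^sup>2" using Suc s0 by (intro power_mono) auto
    also have "\<dots> \<le> s (Suc k)" by (rule sq)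
    finally show ?case .
  qed simp
  \<comment> \<open>One bound for all the quotients: every entry of every power of \<open>B\<close>
    is at most \<open>c\<close> in absolute value.\<close>
  define C where "C = (\<Sum>i<n. \<Sum>j<n. \<bar>v $ i\<bar> * (c * \<bar>v $ j\<bar>)) / (v \<bullet> v)"
  have bd: "s k \<le> C" for k
  proof -
    let ?M = "B ^\<^sub>m (2 ^ k)"
    have M: "?M \<in> carrier_mat n n" using B by simp
    have "v \<bullet> (?M *\<^sub>v v) = (\<Sum>i<n. \<Sum>j<n. v $ i * (?M $$ (i,j) * v $ j))"
      using M v B by (auto simp: scalar_prod_def sum_distrib_left lessThan_atLeast0 intro!: sum.cong)
    also have "\<dots> \<le> (\<Sum>i<n. \<Sum>j<n. \<bar>v $ i\<bar> * (c * \<bar>v $ j\<bar>))"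
    proof (intro sum_mono)
      fix i j assume ij: "i \<in> {..<n}" "j \<in> {..<n}"
      have m: "\<bar>?M $$ (i,j)\<bar> \<le> c" using bnd[of "2 ^ k"] ij B by (auto simp: norm_bound_def)
      have "v $ i * (?M $$ (i,j) * v $ j) \<le> \<bar>v $ i * (?M $$ (i,j) * v $ j)\<bar>" by simp
      also have "\<dots> = \<bar>v $ i\<bar> * (\<bar>?M $$ (i,j)\<bar> * \<bar>v $ j\<bar>)" by (simp add: abs_mult)
      also have "\<dots> \<le> \<bar>v $ i\<bar> * (c * \<bar>v $ j\<bar>)"
        using m by (intro mult_left_mono mult_right_mono) auto
      finally show "v $ i * (?M $$ (i,j) * v $ j) \<le> \<bar>v $ i\<bar> * (c * \<bar>v $ j\<bar>)" .
    qed
    finally show ?thesis using V by (simp add: s_def C_def divide_right_mono)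
  qed
  obtain m where m: "C < s 0 ^ m" using real_arch_pow[OF s0] by blast
  have "s 0 ^ m \<le> s 0 ^ (2 ^ m)" using s0 by (intro power_increasing) (auto simp: less_imp_le)
  also have "\<dots> \<le> C" using grow bd order_trans by blast
  finally show False using m by simp
qed

lemma spectral_radius_real_nonneg:
  assumes "A \<in> carrier_mat n n" "n > 0"
  shows "spectral_radius_real A \<ge> 0"
  unfolding spectral_radius_real_def
  using spectral_radius_mem_max(1)[of "map_mat complex_of_real A" n] assms by auto

text \<open>For \<theta> above the spectral radius, \<open>R\<close> scaled by 1/\<theta> has
  spectral radius below 1, so its powers stay bounded and its Rayleigh quotients are at most 1. Then
  \<theta> decreases to the radius.\<close>

lemma rayleigh_le_spectral_radius:
  fixes R :: "real mat"
  assumes R: "R \<in> carrier_mat n n" and n: "n > 0" and sym: "transpose_mat R = R"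
    and v: "v \<in> carrier_vec n"
  shows "v \<bullet> (R *\<^sub>v v) \<le> spectral_radius_real R * (v \<bullet> v)"
proof -
  define \<rho> where "\<rho> = spectral_radius_real R"
  have le: "v \<bullet> (R *\<^sub>v v) \<le> \<theta> * (v \<bullet> v)" if \<theta>: "\<theta> > \<rho>" for \<theta>
  proof -
    have \<theta>0: "\<theta> > 0" using spectral_radius_real_nonneg[OF R n] \<theta> by (simp add: \<rho>_def)
    define B where "B = (1 / \<theta>) \<cdot>\<^sub>m R"
    let ?c = "map_mat complex_of_real"
    have B: "B \<in> carrier_mat n n" and cB: "?c B \<in> carrier_mat n n" and cR: "?c R \<in> carrier_mat n n"
      using R by (auto simp: B_def)
    have cBeq: "?c B = complex_of_real (1 / \<theta>) \<cdot>\<^sub>m ?c R"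
      by (auto simp: B_def)
    have symB: "transpose_mat B = B"
    proof (rule eq_matI)
      fix i j assume "i < dim_row B" "j < dim_col B"
      then show "transpose_mat B $$ (i,j) = B $$ (i,j)"
        using arg_cong[OF sym, of "\<lambda>A. A $$ (i,j)"] R by (auto simp: B_def)
    qed (use B in auto)
    \<comment> \<open>An eigenvalue \<open>e\<close> of \<open>B\<close> of largest modulus makes
      \<open>of_real \<theta> * e\<close> an eigenvalue of \<open>R\<close>, whence \<theta> * norm
      e \<le> \<rho> < \<theta>.\<close>
    obtain e where e: "e \<in> spectrum (?c B)" and sr: "spectral_radius (?c B) = norm e"
      using spectral_radius_mem_max(1)[OF cB n] by auto
    then obtain w where w: "w \<in> carrier_vec n" "w \<noteq> 0\<^sub>v n" "?c B *\<^sub>v w = e \<cdot>\<^sub>v w"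
      using cB by (auto simp: spectrum_def eigenvalue_def eigenvector_def)
    have "?c R *\<^sub>v w = (of_real \<theta> * e) \<cdot>\<^sub>v w"
    proof -
      have "complex_of_real (1 / \<theta>) \<cdot>\<^sub>v (?c R *\<^sub>v w) = e \<cdot>\<^sub>v w"
        using w(3) cR w(1) unfolding cBeq
        by (simp add: smult_mat_mult_vec)
      then have "of_real \<theta> \<cdot>\<^sub>v (complex_of_real (1 / \<theta>) \<cdot>\<^sub>v (?c R *\<^sub>v w)) = of_real \<theta> \<cdot>\<^sub>v (e \<cdot>\<^sub>v w)"
        by simp
      then show ?thesis using \<theta>0 by (simp add: smult_smult_assoc)
    qed
    then have "of_real \<theta> * e \<in> spectrum (?c R)"
      using w R by (auto simp: spectrum_def eigenvalue_def eigenvector_def)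
    then have "norm (of_real \<theta> * e) \<le> \<rho>"
      using spectral_radius_mem_max(2)[OF cR n] by (auto simp: \<rho>_def spectral_radius_real_def)
    then have "\<theta> * norm e \<le> \<rho>" using \<theta>0 by (simp add: norm_mult)
    then have "\<theta> * norm e < \<theta> * 1" using \<theta> by linarith
    then have "spectral_radius (?c B) < 1"
      unfolding sr using mult_less_cancel_left_pos[OF \<theta>0] by blast
    from spectral_radius_jnf_norm_bound_less_1_upper_triangular[OF cB this]
    obtain c where c: "\<And>k. norm_bound (?c B ^\<^sub>m k) c" by blast
    have bnd: "norm_bound (B ^\<^sub>m k) c" for k
      using c[of k] B unfolding of_real_hom.mat_hom_pow[OF B, symmetric]
      by (auto simp: norm_bound_def)
    have "v \<bullet> (B *\<^sub>v v) \<le> v \<bullet> v" by (rule rayleigh_le_of_power_bounded[OF B symB bnd v])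
    moreover have "v \<bullet> (B *\<^sub>v v) = (v \<bullet> (R *\<^sub>v v)) / \<theta>"
      using R v by (simp add: B_def smult_mat_mult_vec)
    ultimately show ?thesis using \<theta>0 by (simp add: divide_simps mult.commute)
  qed
  show ?thesis
  proof (rule tendsto_lowerbound)
    show "((\<lambda>\<theta>. \<theta> * (v \<bullet> v)) \<longlongrightarrow> spectral_radius_real R * (v \<bullet> v)) (at_right \<rho>)"
      unfolding \<rho>_def by (intro tendsto_intros)
  qed (auto simp: eventually_at_right_less intro!: eventually_mono[OF eventually_at_right_less] le)
qed

subsection \<open>The rate matrix\<close>

text \<open>This is the expectation of \<open>K^T K\<close>. Row \<open>i\<close> of
  \<open>K\<close> has row \<open>i\<close> of \<open>P_q\<close> as its mean, and the covariances
  of the rows sum to the second summand.\<close>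

definition second_moment_mat :: "nat \<Rightarrow> real \<Rightarrow> real mat \<Rightarrow> real mat" where
  "second_moment_mat N q P =
     (transpose_mat (P_q N q P) * P_q N q P) + q\<^sup>2 \<cdot>\<^sub>m (Gamma_mat N P - transpose_mat P * P)"

lemma rate_matrix_second_moment:
  "rate_matrix N q P = (1\<^sub>m N - J_mat N) * second_moment_mat N q P * (1\<^sub>m N - J_mat N)"
  by (simp add: rate_matrix_def second_moment_mat_def)

lemma row_stochasticD:
  assumes "row_stochastic N P"
  shows "P \<in> carrier_mat N N"
    and "\<And>i j. i < N \<Longrightarrow> j < N \<Longrightarrow> P $$ (i,j) \<ge> 0"
    and "\<And>i. i < N \<Longrightarrow> (\<Sum>j<N. P $$ (i,j)) = 1"
  using assms by (auto simp: row_stochastic_def)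

lemma J_mat_carrier: "J_mat N \<in> carrier_mat N N"
  by (simp add: J_mat_def)

lemma transpose_J_mat: "transpose_mat (J_mat N) = J_mat N"
  by (rule eq_matI) (auto simp: J_mat_def)

lemma second_moment_mat_carrier:
  assumes "P \<in> carrier_mat N N"
  shows "second_moment_mat N q P \<in> carrier_mat N N"
  using assms by (intro carrier_matI) (auto simp: second_moment_mat_def P_q_def Gamma_mat_def)

text \<open>The \<open>q^2 P^T P\<close> inside \<open>P_q^T P_q\<close> cancels against the
  subtracted one, which leaves entries affine in \<open>P\<close>. Symmetry, the quadratic form and
  the symmetric case are all read off from this.\<close>

lemma second_moment_mat_index:
  assumes P: "P \<in> carrier_mat N N" and ij: "i < N" "j < N"
  shows "second_moment_mat N q P $$ (i,j) =
    (if i = j then (1 - q)\<^sup>2 + q\<^sup>2 * (\<Sum>k<N. P $$ (k,i)) else 0)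
    + q * (1 - q) * (P $$ (i,j) + P $$ (j,i))"
proof -
  have e: "P_q N q P $$ (k,l) = (if k = l then 1 - q else 0) + q * P $$ (k,l)"
    if "k < N" "l < N" for k l
    using that P by (simp add: P_q_def)
  have d: "dim_row (P_q N q P) = N" "dim_col (P_q N q P) = N"
    using P by (auto simp: P_q_def)
  have "second_moment_mat N q P $$ (i,j) =
    (\<Sum>k<N. P_q N q P $$ (k,i) * P_q N q P $$ (k,j))
    + q\<^sup>2 * ((if i = j then \<Sum>k<N. P $$ (k,i) else 0) - (\<Sum>k<N. P $$ (k,i) * P $$ (k,j)))"
    using P ij d by (simp add: second_moment_mat_def scalar_prod_def Gamma_mat_def lessThan_atLeast0)
  also have "(\<Sum>k<N. P_q N q P $$ (k,i) * P_q N q P $$ (k,j)) =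
    (\<Sum>k<N. (if k = i then (if k = j then (1 - q)\<^sup>2 else 0) else 0)
        + (if k = i then q * (1 - q) * P $$ (k,j) else 0)
        + (if k = j then q * (1 - q) * P $$ (k,i) else 0)
        + q\<^sup>2 * (P $$ (k,i) * P $$ (k,j)))"
    using ij by (intro sum.cong) (auto simp: e algebra_simps power2_eq_square)
  also have "\<dots> = (if i = j then (1 - q)\<^sup>2 else 0) + q * (1 - q) * P $$ (i,j)
        + q * (1 - q) * P $$ (j,i) + q\<^sup>2 * (\<Sum>k<N. P $$ (k,i) * P $$ (k,j))"
    using ij by (simp add: sum.distrib sum_distrib_left)
  finally show ?thesis by (simp add: algebra_simps)
qed

lemma transpose_second_moment_mat:
  assumes "P \<in> carrier_mat N N"
  shows "transpose_mat (second_moment_mat N q P) = second_moment_mat N q P"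
  using second_moment_mat_carrier[OF assms, of q]
  by (intro eq_matI) (auto simp: second_moment_mat_index[OF assms])

lemma rate_matrix_carrier:
  assumes "P \<in> carrier_mat N N"
  shows "rate_matrix N q P \<in> carrier_mat N N"
  using second_moment_mat_carrier[OF assms, of q] J_mat_carrier[of N]
  by (intro carrier_matI) (auto simp: rate_matrix_second_moment)

lemma transpose_rate_matrix:
  assumes P: "P \<in> carrier_mat N N"
  shows "transpose_mat (rate_matrix N q P) = rate_matrix N q P"
proof -
  let ?S = "second_moment_mat N q P" and ?D = "1\<^sub>m N - J_mat N"
  have S: "?S \<in> carrier_mat N N" by (rule second_moment_mat_carrier[OF P])
  have D: "?D \<in> carrier_mat N N" by (simp add: J_mat_carrier minus_carrier_mat)
  have tD: "transpose_mat ?D = ?D"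
    by (simp add: transpose_minus[OF one_carrier_mat J_mat_carrier] transpose_J_mat)
  show ?thesis
    unfolding rate_matrix_second_moment
    unfolding transpose_mult[OF mult_carrier_mat[OF D S] D] transpose_mult[OF D S] tD
      transpose_second_moment_mat[OF P] by (rule assoc_mult_mat[OF D S D, symmetric])
qed

text \<open>The quadratic form of the rate matrix is the mean square of \<open>K z\<close>; the rows of \<open>K\<close> enter
  one at a time.\<close>

lemma rate_matrix_quadratic_form:
  fixes z :: "nat \<Rightarrow> real"
  assumes P: "row_stochastic N P" and z: "(\<Sum>i<N. z i) = 0"
  shows "vec N z \<bullet> (rate_matrix N q P *\<^sub>v vec N z) =
    (\<Sum>i<N. \<Sum>a<N. P $$ (i,a) * ((1 - q) * z i + q * z a)\<^sup>2)"
proof -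
  note PC = row_stochasticD(1)[OF P] and P1 = row_stochasticD(3)[OF P]
  let ?S = "second_moment_mat N q P" and ?D = "1\<^sub>m N - J_mat N" and ?z = "vec N z"
  have S: "?S \<in> carrier_mat N N" by (rule second_moment_mat_carrier[OF PC])
  have D: "?D \<in> carrier_mat N N" by (simp add: J_mat_carrier minus_carrier_mat)
  have zc: "?z \<in> carrier_vec N" by simp
  have tD: "transpose_mat ?D = ?D"
    by (simp add: transpose_minus[OF one_carrier_mat J_mat_carrier] transpose_J_mat)
  \<comment> \<open>A vector of zero sum is killed by \<open>J\<close>, so both outer factors I - J
    disappear: the right one acts on the vector directly, the left one moves across the scalar
    product by symmetry.\<close>
  have "J_mat N *\<^sub>v ?z = 0\<^sub>v N"
    using z by (intro eq_vecI) (auto simp: J_mat_def scalar_prod_def lessThan_atLeast0 sum_divide_distrib[symmetric])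
  then have Dz: "?D *\<^sub>v ?z = ?z"
    by (simp add: minus_mult_distrib_mat_vec[OF one_carrier_mat J_mat_carrier zc])
  have "?z \<bullet> (rate_matrix N q P *\<^sub>v ?z) = ?z \<bullet> (?D *\<^sub>v (?S *\<^sub>v ?z))"
    unfolding rate_matrix_second_moment
    by (simp only: assoc_mult_mat_vec[OF mult_carrier_mat[OF D S] D zc] Dz assoc_mult_mat_vec[OF D S zc])
  also have "\<dots> = (?D *\<^sub>v ?z) \<bullet> (?S *\<^sub>v ?z)"
    using transpose_vec_mult_scalar[OF D mult_mat_vec_carrier[OF S zc] zc] by (simp add: tD)
  also have "\<dots> = (\<Sum>i<N. \<Sum>a<N. z i * ?S $$ (i,a) * z a)"
    using S unfolding Dz by (auto simp: scalar_prod_def lessThan_atLeast0 sum_distrib_left mult.assoc)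
  also have "\<dots> = (\<Sum>i<N. \<Sum>a<N. (if a = i then (1 - q)\<^sup>2 * (z i)\<^sup>2 + q\<^sup>2 * ((\<Sum>k<N. P $$ (k,i)) * (z i)\<^sup>2) else 0)
      + q * (1 - q) * (P $$ (i,a) * z i * z a) + q * (1 - q) * (P $$ (a,i) * z i * z a))"
    by (intro sum.cong refl) (auto simp: second_moment_mat_index[OF PC] algebra_simps power2_eq_square)
  also have "\<dots> = (1 - q)\<^sup>2 * (\<Sum>i<N. (z i)\<^sup>2) + q\<^sup>2 * (\<Sum>i<N. \<Sum>k<N. P $$ (k,i) * (z i)\<^sup>2)
      + q * (1 - q) * (\<Sum>i<N. \<Sum>a<N. P $$ (i,a) * z i * z a)
      + q * (1 - q) * (\<Sum>i<N. \<Sum>a<N. P $$ (a,i) * z i * z a)"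
    by (simp add: sum.distrib sum_distrib_left sum_distrib_right)
  also have "(\<Sum>i<N. \<Sum>a<N. P $$ (a,i) * z i * z a) = (\<Sum>i<N. \<Sum>a<N. P $$ (i,a) * z i * z a)"
    by (subst sum.swap) (simp add: mult_ac)
  also have "(\<Sum>i<N. \<Sum>k<N. P $$ (k,i) * (z i)\<^sup>2) = (\<Sum>i<N. \<Sum>a<N. P $$ (i,a) * (z a)\<^sup>2)"
    by (rule sum.swap)
  \<comment> \<open>Row sums equal to 1 spread this term over \<open>a\<close>, so that all four
    terms share the weights \<open>P $$ (i,a)\<close> and complete the square.\<close>
  also have "(\<Sum>i<N. (z i)\<^sup>2) = (\<Sum>i<N. \<Sum>a<N. P $$ (i,a) * (z i)\<^sup>2)"
    by (simp add: sum_distrib_right[symmetric] P1)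
  finally show ?thesis
    by (simp add: sum_distrib_left sum.distrib[symmetric] algebra_simps power2_eq_square)
qed

section \<open>The symmetric case: rate matrix and eigenvalues\<close>

lemma rate_matrix_symmetric:
  assumes P: "row_stochastic N P" and sym: "transpose_mat P = P"
  shows "rate_matrix N q P =
    ((1 - q)\<^sup>2 + q\<^sup>2) \<cdot>\<^sub>m 1\<^sub>m N + (2 * q * (1 - q)) \<cdot>\<^sub>m P - J_mat N"
proof -
  note PC = row_stochasticD(1)[OF P] and P1 = row_stochasticD(3)[OF P]
  let ?S = "second_moment_mat N q P" and ?J = "J_mat N"
  have S: "?S \<in> carrier_mat N N" by (rule second_moment_mat_carrier[OF PC])
  have symP: "P $$ (i,j) = P $$ (j,i)" if "i < N" "j < N" for i j
    using arg_cong[OF sym, of "\<lambda>A. A $$ (i,j)"] that PC by auto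
  \<comment> \<open>Symmetry makes \<open>P\<close> doubly stochastic, so
    \<open>Gamma_mat N P\<close> is the identity.\<close>
  have col: "(\<Sum>k<N. P $$ (k,i)) = 1" if "i < N" for i
    using P1[OF that] symP that by (metis (no_types, lifting) lessThan_iff sum.cong)
  have Sij: "?S $$ (i,j) = (if i = j then (1 - q)\<^sup>2 + q\<^sup>2 else 0) + 2 * q * (1 - q) * P $$ (i,j)"
    if "i < N" "j < N" for i j
    using that by (simp add: second_moment_mat_index[OF PC] col symP[of j i])
  have row: "(\<Sum>k<N. ?S $$ (i,k)) = 1" if "i < N" for i
  proof -
    have "(\<Sum>k<N. ?S $$ (i,k)) = (\<Sum>k<N. (if k = i then (1 - q)\<^sup>2 + q\<^sup>2 else 0) + 2 * q * (1 - q) * P $$ (i,k))"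
      using that by (intro sum.cong) (auto simp: Sij)
    also have "\<dots> = (1 - q)\<^sup>2 + q\<^sup>2 + 2 * q * (1 - q)"
      using that by (simp add: sum.distrib sum_distrib_left[symmetric] P1)
    also have "\<dots> = 1" by (simp add: power2_eq_square algebra_simps)
    finally show ?thesis .
  qed
  have colS: "(\<Sum>k<N. ?S $$ (k,i)) = 1" if "i < N" for i
  proof -
    have "(\<Sum>k<N. ?S $$ (k,i)) = (\<Sum>k<N. ?S $$ (i,k))"
      using that by (intro sum.cong) (auto simp: Sij symP[of i])
    then show ?thesis using row[OF that] by simp
  qed
  \<comment> \<open>Rows and columns of \<open>?S\<close> sum to 1, so \<open>J\<close> absorbs
    \<open>?S\<close> on either side and (I - J) S (I - J) collapses to S - J.\<close>
  have SJ: "?S * ?J = ?J"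
    using S row by (intro eq_matI)
      (auto simp: J_mat_def scalar_prod_def lessThan_atLeast0 sum_divide_distrib[symmetric])
  have JS: "?J * ?S = ?J"
    using S colS by (intro eq_matI)
      (auto simp: J_mat_def scalar_prod_def lessThan_atLeast0 sum_divide_distrib[symmetric])
  have JJ: "?J * ?J = ?J"
    by (intro eq_matI) (auto simp: J_mat_def scalar_prod_def)
  have SmJ: "?S - ?J \<in> carrier_mat N N" by (simp add: J_mat_carrier minus_carrier_mat)
  have "rate_matrix N q P = (?S - ?J) * (1\<^sub>m N - ?J)"
    unfolding rate_matrix_second_moment
    by (simp add: minus_mult_distrib_mat[OF one_carrier_mat J_mat_carrier S] JS left_mult_one_mat[OF S])
  also have "\<dots> = (?S - ?J) - (?J - ?J)"
    by (simp add: mult_minus_distrib_mat[OF SmJ one_carrier_mat J_mat_carrier] right_mult_one_mat[OF SmJ]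
        minus_mult_distrib_mat[OF S J_mat_carrier J_mat_carrier] SJ JJ)
  also have "\<dots> = ?S - ?J"
    using S J_mat_carrier[of N] by (intro eq_matI) auto
  also have "?S = ((1 - q)\<^sup>2 + q\<^sup>2) \<cdot>\<^sub>m 1\<^sub>m N + (2 * q * (1 - q)) \<cdot>\<^sub>m P"
    using S PC by (intro eq_matI) (auto simp: Sij)
  finally show ?thesis .
qed

text \<open>Maximum principle: where \<open>u\<close> attains its maximum, being an average of its
  successors forces each of them to attain it too, and strong connectivity carries this to all
  nodes.\<close>

lemma irreducible_invariant_const:
  fixes u :: "nat \<Rightarrow> real"
  assumes P: "row_stochastic N P" and irr: "irreducible_mat N P"
    and inv: "\<And>i. i < N \<Longrightarrow> (\<Sum>j<N. P $$ (i,j) * u j) = u i"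
    and ij: "i < N" "j < N"
  shows "u i = u j"
proof -
  define m where "m = Max (u ` {..<N})"
  have le: "u k \<le> m" if "k < N" for k
    unfolding m_def using that by (intro Max_ge) auto
  have "m \<in> u ` {..<N}" unfolding m_def using ij by (intro Max_in) auto
  then obtain k where k: "k < N" "u k = m" by auto
  have step: "u b = m" if "u a = m" "a < N" "b < N" "P $$ (a,b) > 0" for a b
  proof -
    have "(\<Sum>j<N. P $$ (a,j) * (m - u j)) = 0"
      using inv[OF that(2)] row_stochasticD(3)[OF P that(2)] that(1)
      by (simp add: right_diff_distrib sum_subtractf sum_distrib_right[symmetric])
    moreover have "\<forall>j\<in>{..<N}. P $$ (a,j) * (m - u j) \<ge> 0"
      using le row_stochasticD(2)[OF P that(2)] by auto
    ultimately have "P $$ (a,b) * (m - u b) = 0"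
      using that(3) by (subst (asm) sum_nonneg_eq_0_iff) auto
    then show ?thesis using that(4) by simp
  qed
  have all: "u b = m" if "b < N" for b
  proof -
    have "(k,b) \<in> {(a,b). a < N \<and> b < N \<and> P $$ (a,b) > 0}\<^sup>*"
      using irr k that by (auto simp: irreducible_mat_def)
    then show ?thesis by (induction rule: rtrancl_induct) (use k step in auto)
  qed
  show ?thesis using all ij by simp
qed

text \<open>In the row where \<open>v\<close> has largest modulus, the right-hand side is an average
  of entries of no larger modulus.\<close>

lemma row_stochastic_eigenvalue_norm_le:
  fixes v :: "nat \<Rightarrow> complex"
  assumes P: "row_stochastic N P"
    and ev: "\<And>i. i < N \<Longrightarrow> (\<Sum>j<N. of_real (P $$ (i,j)) * v j) = l * v i"
    and nz: "\<exists>i<N. v i \<noteq> 0"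
  shows "norm l \<le> 1"
proof -
  define m where "m = Max ((\<lambda>i. norm (v i)) ` {..<N})"
  have le: "norm (v k) \<le> m" if "k < N" for k
    unfolding m_def using that by (intro Max_ge) auto
  have "m \<in> (\<lambda>i. norm (v i)) ` {..<N}" unfolding m_def using nz by (intro Max_in) auto
  then obtain k where k: "k < N" "norm (v k) = m" by auto
  have m0: "m > 0" using nz le by (meson less_le_trans zero_less_norm_iff)
  have "norm l * m = norm (\<Sum>j<N. of_real (P $$ (k,j)) * v j)"
    using ev[OF k(1)] k(2) by (simp add: norm_mult)
  also have "\<dots> \<le> (\<Sum>j<N. P $$ (k,j) * m)"
    using le row_stochasticD(2)[OF P k(1)]
    by (intro sum_norm_le) (auto simp: norm_mult intro: mult_left_mono)
  also have "\<dots> = m" using row_stochasticD(3)[OF P k(1)] by (simp add: sum_distrib_right[symmetric])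
  finally show ?thesis using m0 by simp
qed

lemma poly_prod_list_linear_eq_0_iff:
  fixes x :: "'a :: idom"
  shows "poly (\<Prod>e\<leftarrow>es. [:- e, 1:]) x = 0 \<longleftrightarrow> x \<in> set es"
  by (induction es) auto

text \<open>An element below another one cannot stand at index 0. It will be applied with
  \<open>y\<close> the eigenvalue 1 of the constant vectors.\<close>

lemma second_le_of_sorted_desc:
  fixes es :: "real list"
  assumes "sorted_wrt (\<ge>) es" "x \<in> set es" "y \<in> set es" "x < y"
  shows "x \<le> es ! 1"
proof -
  obtain i where i: "i < length es" "es ! i = x" using assms(2) by (auto simp: in_set_conv_nth)
  obtain j where j: "j < length es" "es ! j = y" using assms(3) by (auto simp: in_set_conv_nth)
  have "i \<noteq> 0"
  proof
    assume "i = 0"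
    then have "j > 0" using i j assms(4) by (cases j) auto
    then have "es ! j \<le> es ! i" using sorted_wrt_nth_less[OF assms(1) _ j(1), of i] \<open>i = 0\<close> by simp
    then show False using i j assms(4) by simp
  qed
  then have "i = 1 \<or> 1 < i" by auto
  then show ?thesis using sorted_wrt_nth_less[OF assms(1) _ i(1), of 1] i by auto
qed

lemma spectral_radius_rate_matrix_symmetric_le:
  assumes N: "N \<ge> 2" and q: "0 < q" "q < 1"
    and P: "row_stochastic N P" and irr: "irreducible_mat N P"
    and sym: "transpose_mat P = P"
    and es: "char_poly P = (\<Prod>e\<leftarrow>es. [:- e, 1:])" "sorted_wrt (\<ge>) es"
  shows "spectral_radius_real (rate_matrix N q P) \<le> (1 - q)\<^sup>2 + 2 * q * (1 - q) * es ! 1 + q\<^sup>2"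
proof -
  note PC = row_stochasticD(1)[OF P] and P1 = row_stochasticD(3)[OF P]
  let ?c = "map_mat complex_of_real"
  let ?R = "rate_matrix N q P"
  define a where "a = (1 - q)\<^sup>2 + q\<^sup>2"
  define b where "b = 2 * q * (1 - q)"
  have ab: "a + b = 1" by (simp add: a_def b_def power2_eq_square algebra_simps)
  have b0: "b > 0" using q by (simp add: b_def)
  \<comment> \<open>The spectral radius measures moduli, so negative eigenvalues of \<open>P\<close>
    could matter. This inequality rules that out: for x \<ge> -1, a + b x \<ge> a - b \<ge>
    0.\<close>
  have amb: "a - b \<ge> 0"
  proof -
    have "a - b = (1 - 2 * q)\<^sup>2" by (simp add: a_def b_def power2_eq_square algebra_simps)
    then show ?thesis by simp
  qed
  have R: "?R \<in> carrier_mat N N" by (rule rate_matrix_carrier[OF PC])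
  have cR: "?c ?R \<in> carrier_mat N N" and cP: "?c P \<in> carrier_mat N N" using R PC by auto
  have Rij: "?R $$ (i,j) = (if i = j then a else 0) + b * P $$ (i,j) - 1 / N" if "i < N" "j < N" for i j
    using that PC by (simp add: rate_matrix_symmetric[OF P sym] a_def b_def J_mat_def)
  have symP: "P $$ (i,j) = P $$ (j,i)" if "i < N" "j < N" for i j
    using arg_cong[OF sym, of "\<lambda>A. A $$ (i,j)"] that PC by auto
  have col: "(\<Sum>k<N. P $$ (k,i)) = 1" if "i < N" for i
    using P1[OF that] symP that by (metis (no_types, lifting) lessThan_iff sum.cong)

  interpret of_real_poly: map_poly_comm_ring_hom complex_of_real ..
  \<comment> \<open>The characteristic polynomial splits over the reals by assumption, so complex
    eigenvectors of \<open>P\<close> have real eigenvalues from the list.\<close>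
  have in_es: "\<exists>x. l = of_real x \<and> x \<in> set es" if l: "eigenvalue (?c P) l" for l
  proof -
    have cp: "char_poly (?c P) = (\<Prod>e\<leftarrow>map complex_of_real es. [:- e, 1:])"
      unfolding of_real_hom.char_poly_hom[OF PC] es(1)
      by (simp add: of_real_poly.hom_prod_list o_def)
    show ?thesis
      using l unfolding eigenvalue_root_char_poly[OF cP] cp poly_prod_list_linear_eq_0_iff by auto
  qed
  have eigI: "eigenvalue (?c P) l"
    if ev: "\<And>i. i < N \<Longrightarrow> (\<Sum>j<N. of_real (P $$ (i,j)) * v j) = l * v i" and nz: "\<exists>i<N. v i \<noteq> 0" for l v
  proof -
    have "?c P *\<^sub>v vec N v = l \<cdot>\<^sub>v vec N v"
      using ev PC by (intro eq_vecI) (auto simp: scalar_prod_def lessThan_atLeast0)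
    moreover have "vec N v \<noteq> 0\<^sub>v N" using nz by (metis index_vec index_zero_vec(1))
    ultimately show ?thesis
      using PC by (auto simp: eigenvalue_def eigenvector_def intro!: exI[of _ "vec N v"])
  qed
  have one: "1 \<in> set es"
  proof -
    have "eigenvalue (?c P) 1"
      by (rule eigI[of "\<lambda>_. 1"]) (use P1 N in \<open>auto simp flip: of_real_sum intro!: exI[of _ 0]\<close>)
    from in_es[OF this] show ?thesis by (metis of_real_eq_1_iff)
  qed
  have len: "length es = N"
  proof -
    have "degree (\<Prod>e\<leftarrow>es. [:- e, 1:]) = length es" for es :: "real list" 
      by (simp add: degree_linear_factors)
    then show ?thesis using degree_monic_char_poly[OF PC] es(1) by simp
  qed
  \<comment> \<open>This serves the case where the spectral radius is 0: the claimed bound must then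
    be nonnegative.\<close>
  have es1: "- 1 \<le> es ! 1"
  proof -
    have "es ! 1 \<in> set es" using len N by auto
    then have "poly (char_poly P) (es ! 1) = 0" unfolding es(1) poly_prod_list_linear_eq_0_iff .
    then have "eigenvalue P (es ! 1)" using eigenvalue_root_char_poly[OF PC] by simp
    then obtain w where w: "w \<in> carrier_vec N" "w \<noteq> 0\<^sub>v N" "P *\<^sub>v w = (es ! 1) \<cdot>\<^sub>v w"
      using PC by (auto simp: eigenvalue_def eigenvector_def)
    have wi: "(\<Sum>j<N. P $$ (i,j) * w $ j) = es ! 1 * w $ i" if "i < N" for i
      using arg_cong[OF w(3), of "\<lambda>v. v $ i"] that PC w(1)
      by (simp add: scalar_prod_def lessThan_atLeast0)
    have "norm (complex_of_real (es ! 1)) \<le> 1"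
    proof (rule row_stochastic_eigenvalue_norm_le[OF P, of "\<lambda>i. of_real (w $ i)"])
      show "\<exists>i<N. complex_of_real (w $ i) \<noteq> 0"
        using w(1,2) by (metis carrier_vecD eq_vecI index_zero_vec of_real_eq_0_iff)
    qed (simp add: wi flip: of_real_mult of_real_sum)
    then show ?thesis by simp
  qed
  obtain mu where mu: "mu \<in> spectrum (?c ?R)" and sr: "spectral_radius_real ?R = norm mu"
    using spectral_radius_mem_max(1)[OF cR] N by (auto simp: spectral_radius_real_def)
  then obtain w where w: "w \<in> carrier_vec N" "w \<noteq> 0\<^sub>v N" "?c ?R *\<^sub>v w = mu \<cdot>\<^sub>v w"
    using cR by (auto simp: spectrum_def eigenvalue_def eigenvector_def)
  have nz: "\<exists>i<N. w $ i \<noteq> 0"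
    using w(1,2) by (metis carrier_vecD eq_vecI index_zero_vec)
  show ?thesis
  proof (cases "mu = 0")
    case True
    have "b * es ! 1 \<ge> b * (- 1)" using es1 b0 by (intro mult_left_mono) auto
    then show ?thesis using True sr amb by (simp add: a_def b_def)
  next
    case False
    define s where "s = (\<Sum>j<N. w $ j)"
    have ev: "of_real a * w $ i + of_real b * (\<Sum>j<N. of_real (P $$ (i,j)) * w $ j) - s / N = mu * w $ i"
      if i: "i < N" for i
    proof -
      have "mu * w $ i = (\<Sum>j<N. of_real (?R $$ (i,j)) * w $ j)"
        using arg_cong[OF w(3), of "\<lambda>v. v $ i"] i R w(1)
        by (simp add: scalar_prod_def lessThan_atLeast0)
      also have "\<dots> = (\<Sum>j<N. (if j = i then of_real a * w $ i else 0)
          + of_real b * (of_real (P $$ (i,j)) * w $ j) - w $ j / N)"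
        using i by (intro sum.cong) (auto simp: Rij algebra_simps)
      also have "\<dots> = of_real a * w $ i + of_real b * (\<Sum>j<N. of_real (P $$ (i,j)) * w $ j) - s / N"
        using i by (simp add: sum.distrib sum_subtractf sum_distrib_left sum_divide_distrib s_def)
      finally show ?thesis by simp
    qed
    \<comment> \<open>Summing the eigenvalue equation over all rows, with column sums 1, gives mu s
      = (a + b - 1) s = 0. Hence the \<open>J\<close> term vanishes and \<open>w\<close> is an
      eigenvector of \<open>P\<close>.\<close>
    have "mu * s = (\<Sum>i<N. mu * w $ i)" by (simp add: s_def sum_distrib_left)
    also have "\<dots> = (\<Sum>i<N. of_real a * w $ i)
        + of_real b * (\<Sum>i<N. \<Sum>j<N. of_real (P $$ (i,j)) * w $ j) - (\<Sum>i<N. s / N)"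
      by (simp add: ev[symmetric] sum.distrib sum_subtractf sum_distrib_left)
    also have "(\<Sum>i<N. s / N) = s" using N by simp
    also have "(\<Sum>i<N. of_real a * w $ i) = of_real a * s" by (simp add: s_def sum_distrib_left)
    also have "(\<Sum>i<N. \<Sum>j<N. of_real (P $$ (i,j)) * w $ j) = s"
      by (subst sum.swap) (simp add: sum_distrib_right[symmetric] s_def col flip: of_real_sum)
    also have "of_real a * s + of_real b * s - s = (of_real (a + b) - 1) * s" by (simp add: algebra_simps)
    finally have s0: "s = 0" using False ab by simp
    define l where "l = (mu - of_real a) / of_real b"
    have Pl: "(\<Sum>j<N. of_real (P $$ (i,j)) * w $ j) = l * w $ i" if "i < N" for i
      using ev[OF that] b0 by (simp add: s0 l_def field_simps)
    obtain x where x: "l = of_real x" "x \<in> set es" using in_es[OF eigI[OF Pl nz]] by auto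
    have "norm l \<le> 1" by (rule row_stochastic_eigenvalue_norm_le[OF P Pl nz])
    then have x1: "\<bar>x\<bar> \<le> 1" using x by simp
    \<comment> \<open>For x = 1, real and imaginary part of \<open>w\<close> would be constant by
      irreducibility, and the zero sum would make \<open>w\<close> vanish.\<close>
    have "x \<noteq> 1"
    proof
      assume "x = 1"
      obtain k where k: "k < N" "w $ k \<noteq> 0" using nz by auto
      have "w $ i = w $ k" if i: "i < N" for i
      proof (rule complex_eqI)
        show "Re (w $ i) = Re (w $ k)"
          by (rule irreducible_invariant_const[OF P irr _ i k(1)])
             (use arg_cong[OF Pl, of _ Re] \<open>x = 1\<close> x in simp)
        show "Im (w $ i) = Im (w $ k)"
          by (rule irreducible_invariant_const[OF P irr _ i k(1)])
             (use arg_cong[OF Pl, of _ Im] \<open>x = 1\<close> x in simp)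
      qed
      then have "s = of_nat N * w $ k" by (simp add: s_def)
      then show False using s0 k N by simp
    qed
    then have "x \<le> es ! 1" using second_le_of_sorted_desc[OF es(2) x(2) one] x1 by auto
    then have "b * x \<le> b * es ! 1" using b0 by simp
    have "b * x \<ge> b * (- 1)" using x1 b0 by (intro mult_left_mono) auto
    have "mu = of_real (a + b * x)" using x b0 by (simp add: l_def field_simps)
    then have "norm mu = \<bar>a + b * x\<bar>" by (simp only: norm_of_real)
    also have "\<dots> \<le> a + b * es ! 1" using \<open>b * x \<le> _\<close> \<open>b * x \<ge> _\<close> amb by simp
    finally show ?thesis using sr by (simp add: a_def b_def)
  qed
qed

subsection \<open>Duality and dispersion\<close>

lemma push_iter_affine:
  "push_iter N q \<beta> (\<lambda>i. x i - c) \<omega> t i =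
    push_iter N q \<beta> x \<omega> t i - c * push_iter N q \<beta> (\<lambda>_. 1) \<omega> t i"
  by (induction t arbitrary: i) (simp_all add: left_diff_distrib sum_subtractf sum_distrib_left mult.assoc)

lemma sum_K_entry_mult:
  assumes "i < N" "\<beta> t i \<omega> < N"
  shows "(\<Sum>j<N. K_entry q \<beta> t \<omega> i j * u j) = (1 - q) * u i + q * u (\<beta> t i \<omega>)"
proof -
  have "(\<Sum>j<N. K_entry q \<beta> t \<omega> i j * u j) =
    (\<Sum>j<N. (if j = i then (1 - q) * u j else 0) + (if j = \<beta> t i \<omega> then q * u j else 0))"
    by (intro sum.cong) (auto simp: K_entry_def algebra_simps)
  then show ?thesis using assms by (simp add: sum.distrib)
qed

text \<open>After \<open>n\<close> steps this is the product \<open>K(t-n+1) ... K(t) v\<close>. The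
  factor joined in step \<open>Suc n\<close> belongs to time \<open>t - n\<close>, which none of the
  previous factors has used, so it is independent of the vector it acts on.\<close>

fun backward_iter :: "nat \<Rightarrow> real \<Rightarrow> (nat \<Rightarrow> nat \<Rightarrow> 'w \<Rightarrow> nat) \<Rightarrow> nat \<Rightarrow> (nat \<Rightarrow> real) \<Rightarrow> 'w \<Rightarrow> nat \<Rightarrow> nat \<Rightarrow> real" where
  "backward_iter N q \<beta> t v \<omega> 0 = v"
| "backward_iter N q \<beta> t v \<omega> (Suc n) =
     (\<lambda>i. \<Sum>j<N. K_entry q \<beta> (t - n) \<omega> i j * backward_iter N q \<beta> t v \<omega> n j)"

text \<open>Each step moves one matrix from the row vector to the column vector. At
  \<open>n = t\<close> all the randomness sits on the column side.\<close>

lemma push_iter_backward_iter: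
  assumes "n \<le> t"
  shows "(\<Sum>j<N. push_iter N q \<beta> x \<omega> t j * v j) =
    (\<Sum>i<N. push_iter N q \<beta> x \<omega> (t - n) i * backward_iter N q \<beta> t v \<omega> n i)"
  using assms
proof (induction n)
  case (Suc n)
  have s: "t - n = Suc (t - Suc n)" using Suc.prems by simp
  have "(\<Sum>j<N. push_iter N q \<beta> x \<omega> t j * v j) =
    (\<Sum>i<N. push_iter N q \<beta> x \<omega> (t - n) i * backward_iter N q \<beta> t v \<omega> n i)"
    using Suc by simp
  also have "\<dots> = (\<Sum>i<N. \<Sum>k<N. push_iter N q \<beta> x \<omega> (t - Suc n) k * (K_entry q \<beta> (t - n) \<omega> k i
      * backward_iter N q \<beta> t v \<omega> n i))"
    by (simp add: s sum_distrib_right mult.assoc del: backward_iter.simps)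
  also have "\<dots> = (\<Sum>k<N. push_iter N q \<beta> x \<omega> (t - Suc n) k * backward_iter N q \<beta> t v \<omega> (Suc n) k)"
    by (subst sum.swap) (simp add: sum_distrib_left)
  finally show ?case .
qed simp

text \<open>Only the recipients at times in (t - n, t] are consulted. Two different sample spaces
  are allowed so that the iterate can be rewritten as a function of that family of
  recipients.\<close>

lemma backward_iter_cong:
  assumes "n \<le> t" "\<And>s i. t - n < s \<Longrightarrow> s \<le> t \<Longrightarrow> i < N \<Longrightarrow> \<beta> s i \<omega> = \<beta>' s i \<omega>'" "i < N"
  shows "backward_iter N q \<beta> t v \<omega> n i = backward_iter N q \<beta>' t v \<omega>' n i"
  using assms
proof (induction n arbitrary: i)
  case (Suc n)
  have "backward_iter N q \<beta> t v \<omega> n j = backward_iter N q \<beta>' t v \<omega>' n j" if "j < N" for j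
    using Suc that by auto
  moreover have "\<beta> (t - n) i \<omega> = \<beta>' (t - n) i \<omega>'" using Suc.prems by auto
  ultimately show ?case by (simp add: K_entry_def)
qed simp

lemma measurable_backward_iter:
  assumes "n \<le> t"
    and "\<And>s i. t - n < s \<Longrightarrow> s \<le> t \<Longrightarrow> i < N \<Longrightarrow> \<beta> s i \<in> measurable M (count_space UNIV)"
    and "i < N"
  shows "(\<lambda>\<omega>. backward_iter N q \<beta> t v \<omega> n i) \<in> borel_measurable M"
  using assms
proof (induction n arbitrary: i)
  case (Suc n)
  have [measurable]: "(\<lambda>\<omega>. backward_iter N q \<beta> t v \<omega> n j) \<in> borel_measurable M" if "j < N" for j
    using Suc that by auto
  have [measurable]: "\<beta> (t - n) i \<in> measurable M (count_space UNIV)" using Suc.prems by auto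
  show ?case
    unfolding backward_iter.simps K_entry_def
    by (intro borel_measurable_sum borel_measurable_times) auto
qed simp

text \<open>Every step is a convex combination of two old entries. The bound supplies integrability
  below.\<close>

lemma backward_iter_bounded:
  assumes "n \<le> t" "0 \<le> q" "q \<le> 1" "\<And>s i. 1 \<le> s \<Longrightarrow> i < N \<Longrightarrow> \<beta> s i \<omega> < N"
    and "\<And>i. i < N \<Longrightarrow> \<bar>v i\<bar> \<le> 1" "i < N"
  shows "\<bar>backward_iter N q \<beta> t v \<omega> n i\<bar> \<le> 1"
  using assms
proof (induction n arbitrary: i)
  case (Suc n)
  let ?u = "backward_iter N q \<beta> t v \<omega> n"
  have b: "\<beta> (t - n) i \<omega> < N" using Suc.prems by auto
  have "backward_iter N q \<beta> t v \<omega> (Suc n) i = (1 - q) * ?u i + q * ?u (\<beta> (t - n) i \<omega>)"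
    using sum_K_entry_mult[where \<beta> = \<beta>, OF Suc.prems(6) b] by simp
  also have "\<bar>\<dots>\<bar> \<le> (1 - q) * \<bar>?u i\<bar> + q * \<bar>?u (\<beta> (t - n) i \<omega>)\<bar>"
    using Suc.prems(2,3) by (intro order_trans[OF abs_triangle_ineq]) (simp add: abs_mult)
  also have "\<dots> \<le> (1 - q) * 1 + q * 1"
    using Suc b by (intro add_mono mult_left_mono) auto
  finally show ?case by simp
qed simp

section \<open>Dispersion about the mean\<close>

definition centered :: "nat \<Rightarrow> (nat \<Rightarrow> real) \<Rightarrow> nat \<Rightarrow> real" where
  "centered N u i = u i - (\<Sum>k<N. u k) / N"

definition dispersion :: "nat \<Rightarrow> (nat \<Rightarrow> real) \<Rightarrow> real" where
  "dispersion N u = (\<Sum>i<N. (centered N u i)\<^sup>2)"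

lemma sum_centered: "N > 0 \<Longrightarrow> (\<Sum>i<N. centered N u i) = 0"
  by (simp add: centered_def sum_subtractf)

text \<open>The mean minimises the sum of squared deviations. This permits keeping the old mean as
  centre when another matrix is applied.\<close>

lemma dispersion_le: "N > 0 \<Longrightarrow> dispersion N u \<le> (\<Sum>i<N. (u i - c)\<^sup>2)"
proof -
  assume N: "N > 0"
  define m where "m = (\<Sum>k<N. u k) / N"
  have "(\<Sum>i<N. (u i - c)\<^sup>2) = (\<Sum>i<N. (centered N u i)\<^sup>2 + 2 * (m - c) * centered N u i + (m - c)\<^sup>2)"
    by (intro sum.cong) (auto simp: centered_def m_def[symmetric] power2_eq_square algebra_simps)
  also have "\<dots> = dispersion N u + N * (m - c)\<^sup>2"
    by (simp add: sum.distrib sum_distrib_left[symmetric] sum_centered[OF N] dispersion_def)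
  finally show ?thesis by simp
qed

lemma sum_mult_centered:
  assumes "(\<Sum>i<N. y i) = 0"
  shows "(\<Sum>i<N. y i * u i) = (\<Sum>i<N. y i * centered N u i)"
proof -
  define m where "m = (\<Sum>k<N. u k) / N"
  show ?thesis
    using assms unfolding centered_def m_def[symmetric]
    by (simp add: right_diff_distrib sum_subtractf sum_distrib_right[symmetric])
qed

section \<open>Expected decay of the dispersion\<close>

locale push_sum = prob_space M for M :: "'w measure" +
  fixes N :: nat and q :: real and P :: "real mat" and \<beta> :: "nat \<Rightarrow> nat \<Rightarrow> 'w \<Rightarrow> nat"
  assumes N: "N \<ge> 2"
    and q: "0 < q" "q < 1"
    and stoch: "row_stochastic N P"
    and irr: "irreducible_mat N P"
    and indep: "indep_vars (\<lambda>_. count_space UNIV) (\<lambda>(t,i). \<beta> t i) ({1..} \<times> {..<N})"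
    and range: "\<And>t i \<omega>. t \<ge> 1 \<Longrightarrow> i < N \<Longrightarrow> \<omega> \<in> space M \<Longrightarrow> \<beta> t i \<omega> < N"
    and distr: "\<And>t i j. t \<ge> 1 \<Longrightarrow> i < N \<Longrightarrow> j < N \<Longrightarrow>
                  measure M {\<omega> \<in> space M. \<beta> t i \<omega> = j} = P $$ (i,j)"
begin

lemma measurable_recipient:
  assumes "t \<ge> 1" "i < N"
  shows "\<beta> t i \<in> measurable M (count_space UNIV)"
  using indep assms unfolding indep_vars_def by force

lemma measurable_centered_backward_iter:
  assumes "n \<le> t" "i < N"
    and "\<And>s i. t - n < s \<Longrightarrow> s \<le> t \<Longrightarrow> i < N \<Longrightarrow> \<gamma> s i \<in> measurable M' (count_space UNIV)"
  shows "(\<lambda>\<omega>. centered N (backward_iter N q \<gamma> t v \<omega> n) i) \<in> borel_measurable M'"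
  unfolding centered_def
  by (intro borel_measurable_diff borel_measurable_divide borel_measurable_sum borel_measurable_const
      measurable_backward_iter) (use assms in auto)

text \<open>The iterate \<open>z\<close> depends on recipients at times after \<open>t - n\<close>
  only, so it is independent of the recipient at time \<open>t - n\<close> and the expectation
  factors.\<close>

lemma expectation_fresh_recipient:
  assumes n: "n < t" and i: "i < N" and a: "a < N" and v: "\<And>i. i < N \<Longrightarrow> \<bar>v i\<bar> \<le> 1"
  defines "z \<equiv> (\<lambda>k \<omega>. centered N (backward_iter N q \<beta> t v \<omega> n) k)"
  shows "integrable M (\<lambda>\<omega>. of_bool (\<beta> (t - n) i \<omega> = a) * ((1 - q) * z i \<omega> + q * z a \<omega>)\<^sup>2)" (is ?I1)
    and "integrable M (\<lambda>\<omega>. ((1 - q) * z i \<omega> + q * z a \<omega>)\<^sup>2)" (is ?I2)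
    and "expectation (\<lambda>\<omega>. of_bool (\<beta> (t - n) i \<omega> = a) * ((1 - q) * z i \<omega> + q * z a \<omega>)\<^sup>2) =
      P $$ (i,a) * expectation (\<lambda>\<omega>. ((1 - q) * z i \<omega> + q * z a \<omega>)\<^sup>2)" (is ?E)
proof -
  have mb: "\<beta> s k \<in> measurable M (count_space UNIV)" if "t - n < s" "k < N" for s k
    using that by (intro measurable_recipient) auto
  have mz [measurable]: "z k \<in> borel_measurable M" if "k < N" for k
    unfolding z_def using that n mb by (intro measurable_centered_backward_iter) auto
  have mt [measurable]: "\<beta> (t - n) i \<in> measurable M (count_space UNIV)"
    using n i by (intro measurable_recipient) auto
  have zb: "\<bar>z k \<omega>\<bar> \<le> 2" if "\<omega> \<in> space M" "k < N" for k \<omega>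
  proof -
    let ?u = "backward_iter N q \<beta> t v \<omega> n"
    have u: "\<bar>?u j\<bar> \<le> 1" if "j < N" for j
      using that n q v range[OF _ _ \<open>\<omega> \<in> space M\<close>] by (intro backward_iter_bounded) auto
    have "\<bar>\<Sum>k<N. ?u k\<bar> \<le> (\<Sum>k<N. 1)"
      by (intro order_trans[OF sum_abs] sum_mono) (use u in auto)
    then have "\<bar>(\<Sum>k<N. ?u k) / N\<bar> \<le> 1" using N by (simp add: field_simps)
    with u[OF that(2)] show ?thesis unfolding z_def centered_def by linarith
  qed
  have gb: "((1 - q) * z i \<omega> + q * z a \<omega>)\<^sup>2 \<le> 4" if "\<omega> \<in> space M" for \<omega>
  proof -
    have "\<bar>(1 - q) * z i \<omega> + q * z a \<omega>\<bar> \<le> (1 - q) * \<bar>z i \<omega>\<bar> + q * \<bar>z a \<omega>\<bar>"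
      using q by (intro order_trans[OF abs_triangle_ineq]) (simp add: abs_mult)
    also have "\<dots> \<le> (1 - q) * 2 + q * 2"
      using zb[OF that] q i a by (intro add_mono mult_left_mono) auto
    finally have "\<bar>(1 - q) * z i \<omega> + q * z a \<omega>\<bar> \<le> 2" by simp
    from power_mono[OF this, of 2] show ?thesis by simp
  qed
  show I1: ?I1
    by (rule integrable_const_bound[of _ 4]) (use gb i a in \<open>auto intro!: AE_I2\<close>)
  show I2: ?I2
    by (rule integrable_const_bound[of _ 4]) (use gb i a in \<open>auto intro!: AE_I2\<close>)
  \<comment> \<open>Disjoint index sets give independent restricted families. To present both
    factors as measurable functions of these families, the iteration is run again on the product
    space, with the coordinate \<open>b (s,i)\<close> as recipient.\<close>
  let ?A = "{(t - n, i)}" and ?B = "{t - n<..t} \<times> {..<N}"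
  let ?X = "\<lambda>(t,i). \<beta> t i"
  let ?c = "\<lambda>_::nat \<times> nat. count_space (UNIV :: nat set)"
  let ?z = "\<lambda>k b. centered N (backward_iter N q (\<lambda>s i b. b (s,i)) t v b n) k"
  let ?f = "\<lambda>b::nat \<times> nat \<Rightarrow> nat. of_bool (b (t - n, i) = a) :: real"
  let ?g = "\<lambda>b. ((1 - q) * ?z i b + q * ?z a b)\<^sup>2"
  have ind: "indep_var (PiM ?A ?c) (\<lambda>\<omega>. restrict (\<lambda>p. ?X p \<omega>) ?A) (PiM ?B ?c) (\<lambda>\<omega>. restrict (\<lambda>p. ?X p \<omega>) ?B)"
    using n i by (intro indep_var_restrict[OF indep]) auto
  have comp: "(\<lambda>b. b p) \<in> measurable (PiM I ?c) (count_space UNIV)" if "p \<in> I" for p I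
    using measurable_component_singleton[OF that, of ?c] by simp
  have mf: "?f \<in> borel_measurable (PiM ?A ?c)"
    using comp[of "(t - n, i)" ?A] by measurable
  have mz': "?z k \<in> borel_measurable (PiM ?B ?c)" if "k < N" for k
    using that n by (intro measurable_centered_backward_iter comp) auto
  have mg: "?g \<in> borel_measurable (PiM ?B ?c)"
    using mz'[OF i] mz'[OF a] by measurable
  have zz: "?z k (restrict (\<lambda>p. ?X p \<omega>) ?B) = z k \<omega>" if "k < N" for k \<omega>
  proof -
    have "backward_iter N q (\<lambda>s i b. b (s,i)) t v (restrict (\<lambda>p. ?X p \<omega>) ?B) n j =
      backward_iter N q \<beta> t v \<omega> n j" if "j < N" for j
      using n that by (intro backward_iter_cong) auto
    then show ?thesis using that by (simp add: z_def centered_def)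
  qed
  have iv: "indep_var borel (\<lambda>\<omega>. of_bool (\<beta> (t - n) i \<omega> = a) :: real)
      borel (\<lambda>\<omega>. ((1 - q) * z i \<omega> + q * z a \<omega>)\<^sup>2)"
    using indep_var_compose[OF ind mf mg] by (simp add: o_def zz i a)
  have If: "integrable M (\<lambda>\<omega>. of_bool (\<beta> (t - n) i \<omega> = a) :: real)"
    by (rule integrable_const_bound[of _ 1]) auto
  have "expectation (\<lambda>\<omega>. of_bool (\<beta> (t - n) i \<omega> = a) :: real) =
      expectation (indicator {\<omega> \<in> space M. \<beta> (t - n) i \<omega> = a})"
    by (intro Bochner_Integration.integral_cong) (auto simp: indicator_def)
  also have "\<dots> = P $$ (i,a)"
    using distr[of "t - n" i a] n i a by simp
  finally show ?E
    using indep_var_lebesgue_integral[OF iv If I2] by simp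
qed


text \<open>Since \<open>K\<close> fixes constants, subtracting the old mean commutes with it. The
  sum over \<open>a\<close> turns the random index \<open>\<beta> (t - n) i \<omega>\<close> into an
  indicator factor, ready for independence; the inequality comes from the centre being the old
  mean.\<close>

lemma dispersion_backward_iter_Suc_le:
  fixes v :: "nat \<Rightarrow> real"
  assumes n: "n < t" and \<omega>: "\<omega> \<in> space M"
  defines "z \<equiv> (\<lambda>k \<omega>. centered N (backward_iter N q \<beta> t v \<omega> n) k)"
  shows "dispersion N (backward_iter N q \<beta> t v \<omega> (Suc n)) \<le>
    (\<Sum>i<N. \<Sum>a<N. of_bool (\<beta> (t - n) i \<omega> = a) * ((1 - q) * z i \<omega> + q * z a \<omega>)\<^sup>2)"
proof -
  let ?u = "backward_iter N q \<beta> t v \<omega> n"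
  define m where "m = (\<Sum>k<N. ?u k) / N"
  have "dispersion N (backward_iter N q \<beta> t v \<omega> (Suc n)) \<le>
      (\<Sum>i<N. (backward_iter N q \<beta> t v \<omega> (Suc n) i - m)\<^sup>2)"
    using N by (intro dispersion_le) auto
  also have "\<dots> = (\<Sum>i<N. \<Sum>a<N. of_bool (\<beta> (t - n) i \<omega> = a) * ((1 - q) * z i \<omega> + q * z a \<omega>)\<^sup>2)"
  proof (intro sum.cong refl)
    fix i assume "i \<in> {..<N}"
    then have i: "i < N" and b: "\<beta> (t - n) i \<omega> < N" using n \<omega> range by auto
    have "backward_iter N q \<beta> t v \<omega> (Suc n) i = (1 - q) * ?u i + q * ?u (\<beta> (t - n) i \<omega>)"
      using sum_K_entry_mult[where \<beta> = \<beta>, OF i b] by simp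
    then have "backward_iter N q \<beta> t v \<omega> (Suc n) i - m = (1 - q) * z i \<omega> + q * z (\<beta> (t - n) i \<omega>) \<omega>"
      by (simp only: z_def centered_def m_def[symmetric]) (simp add: algebra_simps)
    also have "(\<dots>)\<^sup>2 = (\<Sum>a<N. if a = \<beta> (t - n) i \<omega> then ((1 - q) * z i \<omega> + q * z a \<omega>)\<^sup>2 else 0)"
      using b by simp
    also have "\<dots> = (\<Sum>a<N. of_bool (\<beta> (t - n) i \<omega> = a) * ((1 - q) * z i \<omega> + q * z a \<omega>)\<^sup>2)"
      by (intro sum.cong) auto
    finally show "(backward_iter N q \<beta> t v \<omega> (Suc n) i - m)\<^sup>2 =
      (\<Sum>a<N. of_bool (\<beta> (t - n) i \<omega> = a) * ((1 - q) * z i \<omega> + q * z a \<omega>)\<^sup>2)" .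
  qed
  finally show ?thesis .
qed

abbreviation "\<rho> \<equiv> spectral_radius_real (rate_matrix N q P)"

lemma \<rho>_nonneg: "\<rho> \<ge> 0"
  using spectral_radius_real_nonneg[OF rate_matrix_carrier[OF row_stochasticD(1)[OF stoch]]] N by simp

lemma quadratic_form_le_dispersion:
  "(\<Sum>i<N. \<Sum>a<N. P $$ (i,a) * ((1 - q) * centered N u i + q * centered N u a)\<^sup>2) \<le> \<rho> * dispersion N u"
proof -
  note PC = row_stochasticD(1)[OF stoch]
  have N0: "N > 0" using N by simp
  show ?thesis
    using rayleigh_le_spectral_radius[OF rate_matrix_carrier[OF PC] N0 transpose_rate_matrix[OF PC], of "vec N (centered N u)" q]
    unfolding rate_matrix_quadratic_form[OF stoch sum_centered[OF N0]]
    by (simp add: dispersion_def scalar_prod_def lessThan_atLeast0 power2_eq_square)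
qed

text \<open>Integrating the pathwise bound replaces each indicator by its probability, which leaves
  the quadratic form of the rate matrix at the previous iterate. Each step thus costs at most a
  factor \<rho>.\<close>

lemma expectation_dispersion_backward_iter:
  assumes "n \<le> t" and v: "\<And>i. i < N \<Longrightarrow> \<bar>v i\<bar> \<le> 1"
  shows "integrable M (\<lambda>\<omega>. dispersion N (backward_iter N q \<beta> t v \<omega> n)) \<and>
    expectation (\<lambda>\<omega>. dispersion N (backward_iter N q \<beta> t v \<omega> n)) \<le> \<rho> ^ n * dispersion N v"
  using assms(1)
proof (induction n)
  case 0
  show ?case by (simp add: prob_space)
next
  case (Suc n)
  then have n: "n < t" by simp
  let ?D = "\<lambda>n \<omega>. dispersion N (backward_iter N q \<beta> t v \<omega> n)"
  let ?z = "\<lambda>k \<omega>. centered N (backward_iter N q \<beta> t v \<omega> n) k"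
  let ?s = "\<lambda>i a \<omega>. ((1 - q) * ?z i \<omega> + q * ?z a \<omega>)\<^sup>2"
  let ?F = "\<lambda>\<omega>. \<Sum>i<N. \<Sum>a<N. of_bool (\<beta> (t - n) i \<omega> = a) * ?s i a \<omega>"
  have IH: "integrable M (?D n)" "expectation (?D n) \<le> \<rho> ^ n * dispersion N v" using Suc by auto
  note fresh = expectation_fresh_recipient[OF n _ _ v]
  have IF: "integrable M ?F"
    by (intro Bochner_Integration.integrable_sum fresh) auto
  have le: "?D (Suc n) \<omega> \<le> ?F \<omega>" if "\<omega> \<in> space M" for \<omega>
    by (rule dispersion_backward_iter_Suc_le[OF n that])
  have mD: "?D (Suc n) \<in> borel_measurable M"
    unfolding dispersion_def
    by (intro borel_measurable_sum borel_measurable_power measurable_centered_backward_iter measurable_recipient)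
       (use Suc.prems in auto)
  have ID: "integrable M (?D (Suc n))"
  proof (rule Bochner_Integration.integrable_bound[OF IF mD], rule AE_I2)
    fix \<omega> assume "\<omega> \<in> space M"
    from le[OF this] have "\<bar>?D (Suc n) \<omega>\<bar> \<le> \<bar>?F \<omega>\<bar>"
      by (subst abs_of_nonneg) (auto simp: dispersion_def intro: sum_nonneg order_trans[OF _ abs_ge_self])
    then show "norm (?D (Suc n) \<omega>) \<le> norm (?F \<omega>)" by simp
  qed
  have "expectation (?D (Suc n)) \<le> expectation ?F"
    by (rule integral_mono[OF ID IF le])
  also have "\<dots> = (\<Sum>i<N. \<Sum>a<N. P $$ (i,a) * expectation (?s i a))"
  proof -
    have "expectation ?F = (\<Sum>i<N. expectation (\<lambda>\<omega>. \<Sum>a<N. of_bool (\<beta> (t - n) i \<omega> = a) * ?s i a \<omega>))"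
      by (intro Bochner_Integration.integral_sum Bochner_Integration.integrable_sum fresh) auto
    also have "\<dots> = (\<Sum>i<N. \<Sum>a<N. expectation (\<lambda>\<omega>. of_bool (\<beta> (t - n) i \<omega> = a) * ?s i a \<omega>))"
      by (intro sum.cong refl Bochner_Integration.integral_sum fresh) auto
    also have "\<dots> = (\<Sum>i<N. \<Sum>a<N. P $$ (i,a) * expectation (?s i a))"
      by (intro sum.cong refl fresh) auto
    finally show ?thesis .
  qed
  \<comment> \<open>The sums return inside the expectation because the quadratic form bound holds
    pathwise.\<close>
  also have "\<dots> = expectation (\<lambda>\<omega>. \<Sum>i<N. \<Sum>a<N. P $$ (i,a) * ?s i a \<omega>)"
  proof -
    have "expectation (\<lambda>\<omega>. \<Sum>i<N. \<Sum>a<N. P $$ (i,a) * ?s i a \<omega>) =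
      (\<Sum>i<N. expectation (\<lambda>\<omega>. \<Sum>a<N. P $$ (i,a) * ?s i a \<omega>))"
      by (intro Bochner_Integration.integral_sum Bochner_Integration.integrable_sum integrable_mult_right fresh) auto
    also have "\<dots> = (\<Sum>i<N. \<Sum>a<N. expectation (\<lambda>\<omega>. P $$ (i,a) * ?s i a \<omega>))"
      by (intro sum.cong refl Bochner_Integration.integral_sum integrable_mult_right fresh) auto
    finally show ?thesis by simp
  qed
  also have "\<dots> \<le> expectation (\<lambda>\<omega>. \<rho> * ?D n \<omega>)"
    by (intro integral_mono quadratic_form_le_dispersion integrable_mult_right IH
        Bochner_Integration.integrable_sum fresh) auto
  also have "\<dots> = \<rho> * expectation (?D n)" by simp
  also have "\<dots> \<le> \<rho> * (\<rho> ^ n * dispersion N v)" by (rule mult_left_mono[OF IH(2) \<rho>_nonneg])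
  finally show ?case using ID by simp
qed

section \<open>Almost sure decay of the numerator\<close>

lemma AE_push_iter_square_less:
  assumes y: "(\<Sum>i<N. y i) = 0" and j: "j < N" and \<theta>: "\<theta> > \<rho>"
  shows "AE \<omega> in M. eventually (\<lambda>t. (push_iter N q \<beta> y \<omega> t j)\<^sup>2 < \<theta> ^ t) sequentially"
proof -
  have \<theta>0: "\<theta> > 0" using \<theta> \<rho>_nonneg by simp
  define e where "e k = (if k = j then 1 else 0 :: real)" for k
  let ?u = "\<lambda>t \<omega>. backward_iter N q \<beta> t e \<omega> t"
  define C where "C = (\<Sum>i<N. (y i)\<^sup>2)"
  have C0: "C \<ge> 0" by (simp add: C_def sum_nonneg)
  have eq: "push_iter N q \<beta> y \<omega> t j = (\<Sum>i<N. y i * centered N (?u t \<omega>) i)" for t \<omega>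
  proof -
    have "push_iter N q \<beta> y \<omega> t j = (\<Sum>k<N. push_iter N q \<beta> y \<omega> t k * e k)"
    proof -
      have "(\<Sum>k<N. push_iter N q \<beta> y \<omega> t k * e k) = (\<Sum>k<N. if k = j then push_iter N q \<beta> y \<omega> t k else 0)"
        by (intro sum.cong) (auto simp: e_def)
      then show ?thesis using j by simp
    qed
    also have "\<dots> = (\<Sum>i<N. y i * ?u t \<omega> i)"
      by (subst push_iter_backward_iter[OF order_refl]) simp
    finally show ?thesis using sum_mult_centered[OF y] by simp
  qed
  have le: "(push_iter N q \<beta> y \<omega> t j)\<^sup>2 \<le> C * dispersion N (?u t \<omega>)" for t \<omega>
    unfolding eq C_def dispersion_def by (rule Cauchy_Schwarz_ineq_sum)
  have my: "(\<lambda>\<omega>. push_iter N q \<beta> y \<omega> t j) \<in> borel_measurable M" for t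
    unfolding eq
    by (intro borel_measurable_sum borel_measurable_times borel_measurable_const
        measurable_centered_backward_iter measurable_recipient) auto
  note E = expectation_dispersion_backward_iter[OF order_refl, of e]
  have e1: "\<bar>e i\<bar> \<le> 1" for i by (simp add: e_def)
  define A where "A t = {\<omega> \<in> space M. (push_iter N q \<beta> y \<omega> t j)\<^sup>2 \<ge> \<theta> ^ t}" for t
  have A: "A t \<in> sets M" for t unfolding A_def using my[of t] by measurable
  \<comment> \<open>Markov's inequality yields the ratio \<rho>/\<theta> < 1, so the probabilities
    of the bad events are summable.\<close>
  have mA: "measure M (A t) \<le> C * dispersion N e * (\<rho> / \<theta>) ^ t" for t
  proof -
    have I: "integrable M (\<lambda>\<omega>. C * dispersion N (?u t \<omega>))"
      using E[of t] e1 by (intro integrable_mult_right) auto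
    have I2: "integrable M (\<lambda>\<omega>. (push_iter N q \<beta> y \<omega> t j)\<^sup>2)"
    proof (rule Bochner_Integration.integrable_bound[OF I])
      show "AE \<omega> in M. norm ((push_iter N q \<beta> y \<omega> t j)\<^sup>2) \<le> norm (C * dispersion N (?u t \<omega>))"
        by (intro AE_I2) (use le in \<open>auto intro: order_trans[OF _ abs_ge_self]\<close>)
    qed (use my[of t] in measurable)
    have "measure M (A t) \<le> expectation (\<lambda>\<omega>. (push_iter N q \<beta> y \<omega> t j)\<^sup>2) / \<theta> ^ t"
      unfolding A_def using \<theta>0 by (intro integral_Markov_inequality_measure[OF I2, of "{}"]) auto
    also have "\<dots> \<le> expectation (\<lambda>\<omega>. C * dispersion N (?u t \<omega>)) / \<theta> ^ t"
      using \<theta>0 le by (intro divide_right_mono integral_mono I I2) auto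
    also have "\<dots> \<le> C * (\<rho> ^ t * dispersion N e) / \<theta> ^ t"
      using \<theta>0 C0 E[of t] e1 by (intro divide_right_mono) (auto intro: mult_left_mono)
    finally show ?thesis by (simp add: power_divide mult_ac)
  qed
  have "summable (\<lambda>t. measure M (A t))"
  proof (rule summable_comparison_test')
    show "summable (\<lambda>t. C * dispersion N e * (\<rho> / \<theta>) ^ t)"
      using \<theta> \<theta>0 \<rho>_nonneg by (intro summable_mult summable_geometric) auto
  qed (use mA in simp)
  then have "AE \<omega> in M. eventually (\<lambda>t. \<omega> \<in> space M - A t) sequentially"
    using A by (intro borel_cantelli_AE1) (auto simp: emeasure_eq_measure)
  then show ?thesis
    by eventually_elim (auto elim!: eventually_mono simp: A_def)
qed

subsection \<open>Lower bound on the weights\<close>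

text \<open>The edge is missed throughout the window with probability
  \<open>(1 - p) ^ (t div n)\<close>, which is summable in \<open>t\<close>, so Borel-Cantelli
  applies. Window sizes are indexed by natural numbers \<open>n\<close> so that they can all be
  treated on one almost sure event.\<close>

lemma AE_eventually_recipient_in_window:
  assumes ab: "a < N" "b < N" "P $$ (a,b) > 0" and n: "n \<ge> (1::nat)"
  shows "AE \<omega> in M. eventually (\<lambda>t. \<exists>s. t - t div n < s \<and> s \<le> t \<and> \<beta> s a \<omega> = b) sequentially"
proof -
  define p where "p = P $$ (a,b)"
  have p1: "p \<le> 1" using distr[of 1 a b] ab by (auto simp: p_def[symmetric] dest: sym)
  define A where "A t = {\<omega> \<in> space M. \<forall>s\<in>{t - t div n<..t}. \<beta> s a \<omega> \<noteq> b}" for t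
  have mb [measurable]: "\<beta> s a \<in> measurable M (count_space UNIV)" if "s \<in> {t - t div n<..t}" for s t
    using that ab by (intro measurable_recipient) auto
  have A: "A t \<in> sets M" for t
    unfolding A_def by measurable
  have mA: "measure M (A t) \<le> exp p * exp (- (p / n)) ^ t" for t
  proof -
    have "measure M (A t) \<le> (1 - p) ^ (t div n)"
    \<comment> \<open>For an empty window the bound is 1; the product formula for independent events
      is applied to a nonempty index set.\<close>
    proof (cases "t div n = 0")
      case False
      let ?I = "{t - t div n<..t} \<times> {a}"
      have tn: "t div n \<le> t" by simp
      have "t - t div n < t" using False tn by linarith
      then have ne: "?I \<noteq> {}" by auto
      have "A t = (\<Inter>k\<in>?I. (case k of (s,i) \<Rightarrow> \<beta> s i) -` (- {b}) \<inter> space M)" (is "_ = ?R")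
      proof (rule equalityI)
        show "?R \<subseteq> A t"
        proof
          fix \<omega> assume R: "\<omega> \<in> ?R"
          have "\<omega> \<in> space M \<and> \<beta> s a \<omega> \<noteq> b" if "s \<in> {t - t div n<..t}" for s
            using INT_D[OF R, of "(s,a)"] that by simp
          moreover have "t \<in> {t - t div n<..t}" using \<open>t - t div n < t\<close> by simp
          ultimately show "\<omega> \<in> A t" unfolding A_def by blast
        qed
      qed (auto simp: A_def)
      then have "measure M (A t) = prob ?R" by simp
      also have "\<dots> = (\<Prod>k\<in>?I. prob ((case k of (s,i) \<Rightarrow> \<beta> s i) -` (- {b}) \<inter> space M))"
        using ne ab by (intro indep_varsD[OF indep]) auto
      also have "\<dots> = (\<Prod>k\<in>?I. 1 - p)"
      proof (rule prod.cong)
        fix k assume k: "k \<in> ?I"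
        then obtain s where s: "k = (s,a)" "s \<in> {t - t div n<..t}" by auto
        have "(case k of (s,i) \<Rightarrow> \<beta> s i) -` (- {b}) \<inter> space M = space M - {\<omega> \<in> space M. \<beta> s a \<omega> = b}"
          using s by auto
        moreover have "prob (space M - {\<omega> \<in> space M. \<beta> s a \<omega> = b}) = 1 - p"
          using mb[OF s(2)] distr[of s a b] ab s(2) by (subst prob_compl) (auto simp: p_def)
        ultimately show "prob ((case k of (s,i) \<Rightarrow> \<beta> s i) -` (- {b}) \<inter> space M) = 1 - p" by simp
      qed simp
      also have "\<dots> = (1 - p) ^ (t div n)" using tn by (simp add: card_cartesian_product)
      finally show ?thesis by simp
    qed simp
    also have "\<dots> \<le> exp (- p) ^ (t div n)"
      using p1 exp_ge_add_one_self[of "- p"] by (intro power_mono) auto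
    also have "\<dots> = exp (- (p * real (t div n)))" by (simp add: exp_of_nat_mult[symmetric] mult_ac)
    \<comment> \<open>Rounding loses less than one unit, \<open>t div n\<close> \<ge> t/n - 1, at
      the cost of the constant factor \<open>exp p\<close>.\<close>
    also have "\<dots> \<le> exp (p - p * (t / n))"
    proof -
      have "real t / real n - 1 \<le> real (t div n)" 
      proof -
        have "real (t mod n) / real n \<le> 1" using n by (simp add: less_imp_le)
        then show ?thesis using of_nat_of_nat_div_aux[of t n, where ?'a = real] by linarith
      qed
      then have "p * (real t / real n - 1) \<le> p * real (t div n)"
        using ab by (intro mult_left_mono) (auto simp: p_def)
      then show ?thesis by (simp add: algebra_simps)
    qed
    also have "\<dots> = exp p * exp (- (p / n)) ^ t"
      by (simp add: exp_diff exp_minus exp_of_nat_mult[symmetric] divide_inverse power_inverse mult_ac)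
    finally show ?thesis .
  qed
  have "summable (\<lambda>t. measure M (A t))"
  proof (rule summable_comparison_test')
    show "summable (\<lambda>t. exp p * exp (- (p / n)) ^ t)"
      using ab n by (intro summable_mult summable_geometric) (auto simp: p_def)
  qed (use mA in simp)
  then have "AE \<omega> in M. eventually (\<lambda>t. \<omega> \<in> space M - A t) sequentially"
    using A by (intro borel_cantelli_AE1) (auto simp: emeasure_eq_measure)
  then show ?thesis
    by eventually_elim (auto elim!: eventually_mono simp: A_def)
qed

lemma push_iter_weight_nonneg: "push_iter N q \<beta> (\<lambda>_. 1) \<omega> t i \<ge> 0"
  by (induction t arbitrary: i) (use q in \<open>auto intro!: sum_nonneg mult_nonneg_nonneg simp: K_entry_def\<close>)

lemma sum_push_iter:
  assumes "\<omega> \<in> space M"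
  shows "(\<Sum>i<N. push_iter N q \<beta> y \<omega> t i) = (\<Sum>i<N. y i)"
proof (induction t)
  case (Suc t)
  have "(\<Sum>i<N. push_iter N q \<beta> y \<omega> (Suc t) i) =
    (\<Sum>k<N. push_iter N q \<beta> y \<omega> t k * (\<Sum>i<N. K_entry q \<beta> (Suc t) \<omega> k i * 1))"
    unfolding push_iter.simps by (subst sum.swap) (simp add: sum_distrib_left)
  also have "\<dots> = (\<Sum>k<N. push_iter N q \<beta> y \<omega> t k)"
  proof (intro sum.cong refl)
    fix k assume "k \<in> {..<N}"
    then have "k < N" "\<beta> (Suc t) k \<omega> < N" using range assms by auto
    from sum_K_entry_mult[where \<beta> = \<beta>, OF this, of q "\<lambda>_. 1"]
    show "push_iter N q \<beta> y \<omega> t k * (\<Sum>i<N. K_entry q \<beta> (Suc t) \<omega> k i * 1) = push_iter N q \<beta> y \<omega> t k"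
      by simp
  qed
  finally show ?case using Suc by simp
qed simp

lemma push_iter_weight_Suc_ge:
  assumes "i < N" "j < N"
  shows "push_iter N q \<beta> (\<lambda>_. 1) \<omega> (Suc t) j \<ge> push_iter N q \<beta> (\<lambda>_. 1) \<omega> t i * K_entry q \<beta> (Suc t) \<omega> i j"
  unfolding push_iter.simps
  by (rule member_le_sum[of i "{..<N}" "\<lambda>i. push_iter N q \<beta> (\<lambda>_. 1) \<omega> t i * K_entry q \<beta> (Suc t) \<omega> i j"])
     (use assms q in \<open>auto intro!: mult_nonneg_nonneg push_iter_weight_nonneg simp: K_entry_def\<close>)

text \<open>A node keeps at least the share \<open>1 - q\<close> and passes at least
  \<open>q\<close> to its recipient. The smaller share therefore bounds the loss per time unit along
  any route, waiting or moving.\<close>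

definition min_share :: real where "min_share = min q (1 - q)"

lemma min_share_bounds: "0 < min_share" "min_share \<le> q" "min_share \<le> 1 - q" "min_share < 1"
  using q by (auto simp: min_share_def)

lemma push_iter_weight_stay:
  assumes "i < N" "s \<le> t"
  shows "push_iter N q \<beta> (\<lambda>_. 1) \<omega> t i \<ge> min_share ^ (t - s) * push_iter N q \<beta> (\<lambda>_. 1) \<omega> s i"
  using assms(2)
proof (induction t rule: dec_induct)
  case (step t)
  let ?w = "\<lambda>t. push_iter N q \<beta> (\<lambda>_. 1) \<omega> t i"
  have "min_share ^ (Suc t - s) * ?w s = min_share * (min_share ^ (t - s) * ?w s)" using step by (simp add: Suc_diff_le)
  also have "\<dots> \<le> min_share * ?w t" using step min_share_bounds by (intro mult_left_mono) auto
  also have "\<dots> \<le> ?w t * K_entry q \<beta> (Suc t) \<omega> i i"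
    using min_share_bounds q push_iter_weight_nonneg[of \<omega> t i]
    by (subst mult.commute) (intro mult_left_mono, auto simp: K_entry_def)
  also have "\<dots> \<le> ?w (Suc t)" by (rule push_iter_weight_Suc_ge[OF assms(1) assms(1)])
  finally show ?case .
qed simp

text \<open>The message of time \<open>s\<close> moves weight present at time \<open>s - 1\<close>,
  hence the shifted exponent; afterwards the weight waits at \<open>j\<close> until
  \<open>t\<close>.\<close>

lemma push_iter_weight_hop:
  assumes "i < N" "j < N" "1 \<le> s" "s \<le> t" "\<beta> s i \<omega> = j"
  shows "push_iter N q \<beta> (\<lambda>_. 1) \<omega> t j \<ge> min_share ^ (t - (s - 1)) * push_iter N q \<beta> (\<lambda>_. 1) \<omega> (s - 1) i"
proof -
  let ?w = "\<lambda>t. push_iter N q \<beta> (\<lambda>_. 1) \<omega> t"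
  have "min_share * ?w (s - 1) i \<le> ?w (s - 1) i * K_entry q \<beta> (Suc (s - 1)) \<omega> i j"
    using assms min_share_bounds q push_iter_weight_nonneg[of \<omega> "s - 1" i]
    by (subst mult.commute) (intro mult_left_mono, auto simp: K_entry_def)
  also have "\<dots> \<le> ?w (Suc (s - 1)) j" by (rule push_iter_weight_Suc_ge[OF assms(1,2)])
  finally have *: "min_share * ?w (s - 1) i \<le> ?w s j" using assms by simp
  have "min_share ^ (t - (s - 1)) * ?w (s - 1) i = min_share ^ (t - s) * (min_share * ?w (s - 1) i)"
  proof -
    have "t - (s - 1) = Suc (t - s)" using assms by simp
    then show ?thesis by simp
  qed
  also have "\<dots> \<le> min_share ^ (t - s) * ?w s j" using * min_share_bounds by (intro mult_left_mono) auto
  also have "\<dots> \<le> ?w t j" by (rule push_iter_weight_stay[OF assms(2,4)])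
  finally show ?thesis .
qed

text \<open>Each edge of a path takes half of the remaining window, so mass from any node reaches any
  other node within a window of length \<open>t div n\<close>, whatever \<open>n\<close>.\<close>

lemma push_iter_weight_ge:
  assumes \<omega>: "\<omega> \<in> space M"
    and hit: "\<And>a b n. a < N \<Longrightarrow> b < N \<Longrightarrow> P $$ (a,b) > 0 \<Longrightarrow> n \<ge> (1::nat) \<Longrightarrow>
      eventually (\<lambda>t. \<exists>s. t - t div n < s \<and> s \<le> t \<and> \<beta> s a \<omega> = b) sequentially"
    and n: "n \<ge> 1" and i: "i < N"
  shows "eventually (\<lambda>t. push_iter N q \<beta> (\<lambda>_. 1) \<omega> t i \<ge> min_share ^ (t div n)) sequentially"
proof -
  let ?w = "\<lambda>t. push_iter N q \<beta> (\<lambda>_. 1) \<omega> t"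
  have reach: "eventually (\<lambda>t. \<forall>r. r + t div n \<le> t \<longrightarrow> ?w t i \<ge> min_share ^ (t - r) * ?w r k) sequentially"
    if k: "k < N" for k
  proof -
    have "(k,i) \<in> {(a,b). a < N \<and> b < N \<and> P $$ (a,b) > 0}\<^sup>*"
      using irr k i by (auto simp: irreducible_mat_def)
    then show ?thesis using n
    proof (induction arbitrary: n rule: rtrancl_induct)
      case base
      show ?case by (intro always_eventually allI impI push_iter_weight_stay k) simp
    next
      case (step a b)
      then have ab: "a < N" "b < N" "P $$ (a,b) > 0" by auto
      \<comment> \<open>The last edge gets the final window of length \<open>t div (2 * n)\<close>,
        and the path before it must do with the same parameter \<open>2 * n\<close>; hence
        \<open>n\<close> is generalised in the induction.\<close>
      have n2: "2 * n \<ge> 1" using step.prems by simp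
      obtain T where T: "\<And>t r. t \<ge> T \<Longrightarrow> r + t div (2 * n) \<le> t \<Longrightarrow> ?w t a \<ge> min_share ^ (t - r) * ?w r k"
        using step.IH[OF n2] by (auto simp: eventually_sequentially)
      \<comment> \<open>The prefix has to be complete at time \<open>s - 1\<close> \<ge> t/2, so t
        \<ge> 2T + 2 makes the induction hypothesis available there.\<close>
      show ?case using hit[OF ab n2] eventually_ge_at_top[of "2 * T + 2"]
      proof eventually_elim
        case (elim t)
        then obtain s where s: "t - t div (2 * n) < s" "s \<le> t" "\<beta> s a \<omega> = b" by auto
        show ?case
        proof (intro allI impI)
          fix r assume r: "r + t div n \<le> t"
          have half: "t div (2 * n) \<le> t div 2" using step.prems by (intro div_le_mono2) auto
          have two: "2 * (t div (2 * n)) \<le> t div n"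
            using div_mult2_eq[of t n 2] by (simp add: mult.commute)
          have sT: "s - 1 \<ge> T" using s half elim by linarith
          have mono: "(s - 1) div (2 * n) \<le> t div (2 * n)" using s by (intro div_le_mono) auto
          \<comment> \<open>Two windows of length \<open>t div (2 * n)\<close> fit into one of
            length \<open>t div n\<close>.\<close>
          have r': "r + (s - 1) div (2 * n) \<le> s - 1" using r s two mono by linarith
          have "min_share ^ (t - r) * ?w r k = min_share ^ (t - (s - 1)) * (min_share ^ (s - 1 - r) * ?w r k)"
          proof -
            have "t - r = (t - (s - 1)) + (s - 1 - r)" using r' s by linarith
            then show ?thesis by (simp add: power_add)
          qed
          also have "\<dots> \<le> min_share ^ (t - (s - 1)) * ?w (s - 1) a"
            using T[OF sT r'] min_share_bounds by (intro mult_left_mono) auto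
          also have "\<dots> \<le> ?w t b"
            using s by (intro push_iter_weight_hop ab) auto
          finally show "?w t b \<ge> min_share ^ (t - r) * ?w r k" .
        qed
      qed
    qed
  qed
  have "eventually (\<lambda>t. \<forall>k\<in>{..<N}. \<forall>r. r + t div n \<le> t \<longrightarrow> ?w t i \<ge> min_share ^ (t - r) * ?w r k) sequentially"
    by (intro eventually_ball_finite ballI reach) auto
  then show ?thesis
  proof eventually_elim
    case (elim t)
    let ?r = "t - t div n"
    have tn: "t div n \<le> t" by simp
    \<comment> \<open>The total weight stays \<open>N\<close>, so some node carries at least the
      average 1.\<close>
    have "\<exists>k<N. ?w ?r k \<ge> 1"
    proof (rule ccontr)
      assume "\<not> ?thesis"
      moreover have "{..<N} \<noteq> {}" using N by (auto simp: lessThan_empty_iff)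
      ultimately have "(\<Sum>k<N. ?w ?r k) < (\<Sum>k<N. 1)" by (intro sum_strict_mono) (auto simp: not_le)
      then show False using sum_push_iter[OF \<omega>, of "\<lambda>_. 1" ?r] by simp
    qed
    then obtain k where k: "k < N" "?w ?r k \<ge> 1" by auto
    have "min_share ^ (t div n) * 1 \<le> min_share ^ (t div n) * ?w ?r k" using k min_share_bounds by (intro mult_left_mono) auto
    also have "\<dots> \<le> ?w t i" using elim[THEN bspec, of k, THEN spec, of ?r] k tn by auto
    finally show ?case by simp
  qed
qed

subsection \<open>Convergence rate\<close>

text \<open>With \<delta> half of the gap below \<open>r\<close>, the numerator can still decay at
  rate r - \<delta>, and the remaining \<delta> pays for the denominator. If
  \<open>elog \<rho>\<close> is -\<infinity>, any \<delta> will do.\<close>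

lemma half_elog_less_exp_gap:
  assumes r: "ereal (1/2) * elog \<rho> < ereal r"
  obtains \<delta> where "\<delta> > 0" "\<rho> < exp (2 * (r - \<delta>))"
proof (cases "\<rho> > 0")
  case True
  then have "ln \<rho> / 2 < r" using r by (simp add: elog_def)
  then show ?thesis using True by (intro that[of "(r - ln \<rho> / 2) / 2"]) (auto simp: field_simps ln_less_cancel_iff[symmetric, of \<rho>])
next
  case False
  then show ?thesis by (intro that[of 1]) (auto intro: le_less_trans[of _ 0])
qed

lemma AE_push_rate_le:
  assumes r: "ereal (1/2) * elog \<rho> < ereal r"
  shows "AE \<omega> in M. eventually (\<lambda>t. push_rate N q \<beta> x0 \<omega> t \<le> ereal r) sequentially"
proof -
  obtain \<delta> where \<delta>: "\<delta> > 0" "\<rho> < exp (2 * (r - \<delta>))" by (rule half_elog_less_exp_gap[OF r])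
  define xb where "xb = (\<Sum>k<N. x0 k) / real N"
  let ?y = "\<lambda>i. x0 i - xb"
  let ?w = "push_iter N q \<beta> (\<lambda>_. 1)"
  have y0: "(\<Sum>i<N. ?y i) = 0" using N by (simp add: sum_subtractf xb_def)
  have lc: "ln min_share \<le> 0" using min_share_bounds by simp
  \<comment> \<open>The window is made so short that losing the factor \<open>min_share\<close> at
    each of its times costs at most exp(-\<delta> t).\<close>
  obtain n :: nat where n: "n \<ge> 1" "- ln min_share \<le> \<delta> * n"
  proof -
    obtain m :: nat where "- ln min_share / \<delta> < m" using reals_Archimedean2 by blast
    then have "- ln min_share \<le> \<delta> * Suc m" using \<delta>(1) by (simp add: field_simps)
    then show ?thesis using that[of "Suc m"] by simp
  qed
  have cn: "exp (- (\<delta> * t)) \<le> min_share ^ (t div n)" for t :: nat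
  proof -
    have "real (t div n) \<le> t / n" by (rule of_nat_div_le_of_nat)
    then have "(- ln min_share) * real (t div n) \<le> (- ln min_share) * (t / n)" using lc by (intro mult_left_mono) auto
    also have "\<dots> \<le> (\<delta> * n) * (t / n)" using n by (intro mult_right_mono) auto
    also have "\<dots> = \<delta> * t" using n by simp
    finally have "- (\<delta> * t) \<le> real (t div n) * ln min_share" by (simp add: mult.commute)
    then have "exp (- (\<delta> * t)) \<le> exp (real (t div n) * ln min_share)" by simp
    also have "\<dots> = min_share ^ (t div n)" using min_share_bounds by (simp add: exp_of_nat_mult)
    finally show ?thesis .
  qed
  have "AE \<omega> in M. \<forall>j\<in>{..<N}. eventually (\<lambda>t. (push_iter N q \<beta> ?y \<omega> t j)\<^sup>2 < exp (2 * (r - \<delta>)) ^ t) sequentially"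
    by (intro AE_ball_countable[THEN iffD2] ballI AE_push_iter_square_less[OF y0 _ \<delta>(2)]) auto
  \<comment> \<open>All \<open>n\<close> are covered at once because the path argument doubles
    \<open>n\<close> at every edge; the index set is countable.\<close>
  moreover have "AE \<omega> in M. \<forall>p\<in>{(a,b,n). a < N \<and> b < N \<and> P $$ (a,b) > 0 \<and> n \<ge> (1::nat)}. case p of (a,b,n) \<Rightarrow>
      eventually (\<lambda>t. \<exists>s. t - t div n < s \<and> s \<le> t \<and> \<beta> s a \<omega> = b) sequentially"
    by (intro AE_ball_countable[THEN iffD2] ballI) (auto intro: AE_eventually_recipient_in_window)
  ultimately show ?thesis using AE_space
  proof eventually_elim
    case (elim \<omega>)
    have hit: "eventually (\<lambda>t. \<exists>s. t - t div n < s \<and> s \<le> t \<and> \<beta> s a \<omega> = b) sequentially"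
      if "a < N" "b < N" "P $$ (a,b) > 0" "n \<ge> (1::nat)" for a b n
      using elim(2)[THEN bspec, of "(a,b,n)"] that by simp
    have "eventually (\<lambda>t. \<forall>j\<in>{..<N}. (push_iter N q \<beta> ?y \<omega> t j)\<^sup>2 < exp (2 * (r - \<delta>)) ^ t) sequentially"
      using elim(1) by (intro eventually_ball_finite) auto
    moreover have "eventually (\<lambda>t. \<forall>j\<in>{..<N}. min_share ^ (t div n) \<le> ?w \<omega> t j) sequentially"
      by (intro eventually_ball_finite ballI push_iter_weight_ge[OF elim(3) hit n(1)]) auto
    ultimately show ?case using eventually_gt_at_top[of 0]
    proof eventually_elim
      case (elim t)
      have "elog \<bar>push_iter N q \<beta> x0 \<omega> t i / ?w \<omega> t i - xb\<bar> \<le> ereal (r * t)" if i: "i < N" for i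
      proof -
        let ?W = "?w \<omega> t i" and ?Y = "push_iter N q \<beta> ?y \<omega> t i"
        have W: "exp (- (\<delta> * t)) \<le> ?W" using cn[of t] elim(2) i by force
        then have W0: "?W > 0" using exp_gt_zero less_le_trans by blast
        have "?Y\<^sup>2 < exp (2 * (r - \<delta>)) ^ t" using elim(1) i by simp
        also have "\<dots> = (exp ((r - \<delta>) * t))\<^sup>2" 
          unfolding exp_of_nat_mult[symmetric] exp_double[symmetric] by (simp add: mult_ac)
        finally have Y: "\<bar>?Y\<bar> \<le> exp ((r - \<delta>) * t)" by (intro power2_le_imp_le[of "\<bar>?Y\<bar>"]) auto
        have "\<bar>push_iter N q \<beta> x0 \<omega> t i / ?W - xb\<bar> = \<bar>?Y\<bar> / ?W"
        proof -
          have "push_iter N q \<beta> x0 \<omega> t i / ?W - xb = ?Y / ?W"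
            using W0 by (simp add: push_iter_affine diff_divide_distrib)
          then show ?thesis using W0 by simp
        qed
        also have "\<dots> \<le> exp ((r - \<delta>) * t) / exp (- (\<delta> * t))"
          using W Y by (intro frac_le) auto
        also have "\<dots> = exp (r * t)" by (simp add: exp_diff[symmetric] algebra_simps)
        finally have b: "\<bar>push_iter N q \<beta> x0 \<omega> t i / ?W - xb\<bar> \<le> exp (r * t)" .
        show ?thesis
        proof (cases "\<bar>push_iter N q \<beta> x0 \<omega> t i / ?W - xb\<bar> > 0")
          case True
          then have "ln \<bar>push_iter N q \<beta> x0 \<omega> t i / ?W - xb\<bar> \<le> r * t"
            using b ln_mono[of _ "exp (r * t)"] by fastforce
          then show ?thesis using True by (simp add: elog_def)
        qed (simp add: elog_def)
      qed
      then have "Max ((\<lambda>i. elog \<bar>push_iter N q \<beta> x0 \<omega> t i / ?w \<omega> t i - xb\<bar>) ` {..<N}) \<le> ereal (r * t)"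
        using N by (subst Max_le_iff) (auto simp: lessThan_empty_iff)
      then have "push_rate N q \<beta> x0 \<omega> t \<le> ereal (1 / real t) * ereal (r * t)"
        unfolding push_rate_def xb_def by (intro ereal_mult_left_mono) auto
      also have "\<dots> = ereal r" using elim(3) by simp
      finally show ?case .
    qed
  qed
qed

text \<open>Countably many almost sure events may be intersected, so the bounds are taken at
  rational \<open>r\<close>. A limsup above the claimed bound would leave room for such an
  \<open>r\<close> in between.\<close>

lemma AE_limsup_push_rate_le:
  "AE \<omega> in M. limsup (push_rate N q \<beta> x0 \<omega>) \<le> ereal (1/2) * elog \<rho>"
proof -
  let ?B = "ereal (1/2) * elog \<rho>"
  have "AE \<omega> in M. \<forall>r\<in>{r::rat. ?B < ereal (of_rat r)}.
      eventually (\<lambda>t. push_rate N q \<beta> x0 \<omega> t \<le> ereal (of_rat r)) sequentially"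
    by (intro AE_ball_countable[THEN iffD2] ballI AE_push_rate_le) auto
  then show ?thesis
  proof eventually_elim
    case (elim \<omega>)
    show ?case
    proof (rule ccontr)
      assume "\<not> ?thesis"
      then have "?B < limsup (push_rate N q \<beta> x0 \<omega>)" by simp
      from ereal_dense3[OF this] obtain r :: rat
        where r: "?B < ereal (of_rat r)" "ereal (of_rat r) < limsup (push_rate N q \<beta> x0 \<omega>)" by auto
      have "limsup (push_rate N q \<beta> x0 \<omega>) \<le> ereal (of_rat r)"
        using elim r(1) by (intro Limsup_bounded) auto
      with r(2) show False by simp
    qed
  qed
qed

end

lemma elog_mono: "x \<le> y \<Longrightarrow> elog x \<le> elog y"
  by (auto simp: elog_def)

theorem theorem1:
  fixes N :: nat and q :: real and P :: "real mat" and M :: "'w measure"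
    and \<beta> :: "nat \<Rightarrow> nat \<Rightarrow> 'w \<Rightarrow> nat" and x0 :: "nat \<Rightarrow> real"
  assumes N: "N \<ge> 2"
    and q: "0 < q" "q < 1"
    and stoch: "row_stochastic N P"
    and irr: "irreducible_mat N P"
    and M: "prob_space M"
    and indep: "prob_space.indep_vars M (\<lambda>_. count_space UNIV) (\<lambda>(t,i). \<beta> t i) ({1..} \<times> {..<N})"
    and range: "\<And>t i \<omega>. t \<ge> 1 \<Longrightarrow> i < N \<Longrightarrow> \<omega> \<in> space M \<Longrightarrow> \<beta> t i \<omega> < N"
    and distr: "\<And>t i j. t \<ge> 1 \<Longrightarrow> i < N \<Longrightarrow> j < N \<Longrightarrow>
                  measure M {\<omega> \<in> space M. \<beta> t i \<omega> = j} = P $$ (i,j)"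
  shows "(AE \<omega> in M. limsup (push_rate N q \<beta> x0 \<omega>)
            \<le> ereal (1/2) * elog (spectral_radius_real (rate_matrix N q P)))
         \<and> (transpose_mat P = P \<longrightarrow>
              (\<forall>es. char_poly P = (\<Prod>e\<leftarrow>es. [:- e, 1:]) \<and> sorted_wrt (\<ge>) es \<longrightarrow>
                 (AE \<omega> in M. limsup (push_rate N q \<beta> x0 \<omega>)
                    \<le> ereal (1/2) * elog ((1 - q)\<^sup>2 + 2 * q * (1 - q) * es ! 1 + q\<^sup>2))))"
proof -
  interpret push_sum M N q P \<beta>
    using assms by (auto simp: push_sum_def push_sum_axioms_def)
  have main: "AE \<omega> in M. limsup (push_rate N q \<beta> x0 \<omega>) \<le> ereal (1/2) * elog \<rho>"
    by (rule AE_limsup_push_rate_le)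
  show ?thesis
  proof (intro conjI impI allI main)
    fix es assume sym: "transpose_mat P = P"
      and es: "char_poly P = (\<Prod>e\<leftarrow>es. [:- e, 1:]) \<and> sorted_wrt (\<ge>) es"
    \<comment> \<open>The symmetric case only compares two deterministic bounds; the almost sure
      statement is the one already obtained.\<close>
    have "\<rho> \<le> (1 - q)\<^sup>2 + 2 * q * (1 - q) * es ! 1 + q\<^sup>2"
      using spectral_radius_rate_matrix_symmetric_le[OF N q stoch irr sym] es by simp
    then have "ereal (1/2) * elog \<rho> \<le> ereal (1/2) * elog ((1 - q)\<^sup>2 + 2 * q * (1 - q) * es ! 1 + q\<^sup>2)"
      by (intro ereal_mult_left_mono elog_mono) auto
    then show "AE \<omega> in M. limsup (push_rate N q \<beta> x0 \<omega>) \<le>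
        ereal (1/2) * elog ((1 - q)\<^sup>2 + 2 * q * (1 - q) * es ! 1 + q\<^sup>2)"
      using main by (auto elim: order_trans)
  qed
qed

end
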